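(* Let $E$ be an elementary abelian $p$-group of rank $n$. For any integer $r$ with $1<r<n$, there exists a finite dimensional $kE$-module which has constant $r$-radical type but which does not have constant $s$-radical type for any $s$ with $1\le s<r$.
   Context: $k$ is an algebraically closed field of characteristic $p>0$. $\mathbb V\subset\operatorname{Rad}(kE)$ is a fixed linear subspace such that $\mathbb V\hookrightarrow\operatorname{Rad}(kE)\to\operatorname{Rad}(kE)/\operatorname{Rad}^2(kE)$ is an isomorphism. For a linear subspace $U\subset\mathbb V$ and a $kE$-module $M$, $\operatorname{Rad}^j_U(M)$ is the span of all $u_1\cdots u_j m$ with $u_i\in U$, $m\in M$. A finite dimensional $kE$-module $M$ has constant $r$-radical type if for every $j$ with $1\le j\le(p-1)r$ the dimension of $\operatorname{Rad}^j_U(M)$ is independent of the choice of the $r$-dimensional subspace $U\subset\mathbb V$. *)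

theory Defs
  imports
    "HOL-Algebra.Algebra"
    "Jordan_Normal_Form.Missing_VectorSpace"
begin

definition has_characteristic :: "('k, 'r) ring_scheme \<Rightarrow> nat \<Rightarrow> bool" where
  "has_characteristic R p \<longleftrightarrow> (\<forall>m::nat. add_pow R m \<one>\<^bsub>R\<^esub> = \<zero>\<^bsub>R\<^esub> \<longleftrightarrow> p dvd m)"

definition elementary_abelian :: "nat \<Rightarrow> nat \<Rightarrow> ('e, 'g) monoid_scheme \<Rightarrow> bool" where
  "elementary_abelian p n E \<longleftrightarrow>
     group E \<and> E \<cong> product_group {..<n} (\<lambda>_. integer_mod_group p)"

text \<open>The group algebra of a finite group, with convolution as multiplication. The function \<open>a\<close>
  stands for the formal sum of the \<open>a x \<cdot> x\<close> with \<open>x \<in> carrier E\<close>. The same record serves as a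
  ring and, through \<open>smult\<close>, as a vector space over \<open>K\<close>.\<close>

definition group_algebra ::
    "('k, 'r) ring_scheme \<Rightarrow> ('e, 'g) monoid_scheme \<Rightarrow> ('k, 'e \<Rightarrow> 'k) module" where
  "group_algebra K E =
     \<lparr>carrier = carrier E \<rightarrow>\<^sub>E carrier K,
      monoid.mult = (\<lambda>a b. \<lambda>x\<in>carrier E.
        \<Oplus>\<^bsub>K\<^esub>y\<in>carrier E. a y \<otimes>\<^bsub>K\<^esub> b (inv\<^bsub>E\<^esub> y \<otimes>\<^bsub>E\<^esub> x)),
      one = (\<lambda>x\<in>carrier E. if x = \<one>\<^bsub>E\<^esub> then \<one>\<^bsub>K\<^esub> else \<zero>\<^bsub>K\<^esub>),
      ring.zero = (\<lambda>x\<in>carrier E. \<zero>\<^bsub>K\<^esub>),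
      add = (\<lambda>a b. \<lambda>x\<in>carrier E. a x \<oplus>\<^bsub>K\<^esub> b x),
      module.smult = (\<lambda>c a. \<lambda>x\<in>carrier E. c \<otimes>\<^bsub>K\<^esub> a x)\<rparr>"

text \<open>The Jacobson radical of a commutative ring (for which left, right and two-sided maximal
  ideals coincide).\<close>

definition jacobson_radical :: "('a, 'b) ring_scheme \<Rightarrow> 'a set" where
  "jacobson_radical R = carrier R \<inter> \<Inter>{I. maximalideal I R}"

text \<open>\<open>V\<close> maps isomorphically to \<open>Rad / Rad\<^sup>2\<close>. The coset map is linear, so bijectivity suffices.\<close>

definition rad_complement ::
    "('k, 'r) ring_scheme \<Rightarrow> ('e, 'g) monoid_scheme \<Rightarrow> ('e \<Rightarrow> 'k) set \<Rightarrow> bool" where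
  "rad_complement K E V \<longleftrightarrow>
     (let A = group_algebra K E; J = jacobson_radical A; J2 = ideal_prod A J J
      in VectorSpace.subspace K V A \<and> V \<subseteq> J \<and>
         bij_betw (\<lambda>v. J2 +>\<^bsub>A\<^esub> v) V (carrier ((A\<lparr>carrier := J\<rparr>) A_Mod J2)))"

text \<open>A \<open>kE\<close>-module viewed as a vector space over \<open>K\<close> along \<open>c \<mapsto> c \<cdot> 1\<close>. The fields \<open>mult\<close> and
  \<open>one\<close>, which the record type of modules inherits from rings, play no role for modules.\<close>

definition underlying_space ::
    "('k, 'r) ring_scheme \<Rightarrow> ('e, 'g) monoid_scheme \<Rightarrow> ('e \<Rightarrow> 'k, 'm) module \<Rightarrow> ('k, 'm) module"
  where
  "underlying_space K E M =
     \<lparr>carrier = carrier M, monoid.mult = monoid.mult M, one = \<one>\<^bsub>M\<^esub>,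
      ring.zero = \<zero>\<^bsub>M\<^esub>, add = ring.add M,
      module.smult = (\<lambda>c m.
        (c \<odot>\<^bsub>group_algebra K E\<^esub> \<one>\<^bsub>group_algebra K E\<^esub>) \<odot>\<^bsub>M\<^esub> m)\<rparr>"

definition finite_dim_kE_module ::
    "('k, 'r) ring_scheme \<Rightarrow> ('e, 'g) monoid_scheme \<Rightarrow> ('e \<Rightarrow> 'k, 'm) module \<Rightarrow> bool" where
  "finite_dim_kE_module K E M \<longleftrightarrow>
     Module.module (group_algebra K E) M \<and> vectorspace.fin_dim K (underlying_space K E M)"

definition subspace_dim ::
    "('k, 'r) ring_scheme \<Rightarrow> ('k, 'v) module \<Rightarrow> 'v set \<Rightarrow> nat" where
  "subspace_dim K A W = vectorspace.dim K (A\<lparr>carrier := W\<rparr>)"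

definition subspaces_of_dim ::
    "('k, 'r) ring_scheme \<Rightarrow> ('e, 'g) monoid_scheme \<Rightarrow> ('e \<Rightarrow> 'k) set \<Rightarrow> nat \<Rightarrow> ('e \<Rightarrow> 'k) set set"
  where
  "subspaces_of_dim K E V r =
     {U. VectorSpace.subspace K U (group_algebra K E) \<and> U \<subseteq> V \<and>
         subspace_dim K (group_algebra K E) U = r}"

definition Rad_U ::
    "('k, 'r) ring_scheme \<Rightarrow> ('e, 'g) monoid_scheme \<Rightarrow> ('e \<Rightarrow> 'k) set \<Rightarrow> nat
      \<Rightarrow> ('e \<Rightarrow> 'k, 'm) module \<Rightarrow> 'm set" where
  "Rad_U K E U j M =
     LinearCombinations.module.span K (underlying_space K E M)
       {foldr (\<lambda>u x. u \<odot>\<^bsub>M\<^esub> x) us m | us m.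
          length us = j \<and> set us \<subseteq> U \<and> m \<in> carrier M}"

definition constant_radical_type ::
    "('k, 'r) ring_scheme \<Rightarrow> nat \<Rightarrow> ('e, 'g) monoid_scheme \<Rightarrow> ('e \<Rightarrow> 'k) set \<Rightarrow> nat
      \<Rightarrow> ('e \<Rightarrow> 'k, 'm) module \<Rightarrow> bool" where
  "constant_radical_type K p E V r M \<longleftrightarrow>
     (\<forall>j. 1 \<le> j \<and> j \<le> (p - 1) * r \<longrightarrow>
        (\<forall>U\<in>subspaces_of_dim K E V r. \<forall>U'\<in>subspaces_of_dim K E V r.
           subspace_dim K (underlying_space K E M) (Rad_U K E U j M) =
           subspace_dim K (underlying_space K E M) (Rad_U K E U' j M)))"

text \<open>The existence theorem takes modules with carrier in \<open>nat \<Rightarrow> 'k\<close>. This is no restriction up to isomorphism: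
  a vector space of dimension \<open>d\<close> over \<open>K\<close> is isomorphic to one carried by the functions from
  \<open>{..<d}\<close> to \<open>carrier K\<close>.\<close>

end

theory Submission
  imports Defs
begin

text \<open>Let \<open>\<phi>\<^sub>0, \<dots>, \<phi>\<^sub>n\<^sub>-\<^sub>1\<close> be the derivations \<open>kE \<rightarrow> k\<close> at the augmentation given by the coordinates
  \<open>E \<rightarrow> \<int>/p \<subseteq> k\<close>. The Jacobson radical is the augmentation ideal, and an element of it lies in its
  square iff all \<open>\<phi>\<^sub>i\<close> vanish on it, so the \<open>\<phi>\<^sub>i\<close> are linear coordinates on \<open>V\<close>. Let \<open>M\<close> be the module
  of Loewy length two with top \<open>k\<^bsup>T\<^esup>\<close>, \<open>T = {r - 1, \<dots>, n - 1}\<close>, and one-dimensional socle, on which \<open>u \<in> V\<close>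
  sends a top vector \<open>m\<close> to \<open>\<Sum>t\<in>T. \<phi>\<^sub>t(u) m\<^sub>t\<close>. Then \<open>Rad\<^sub>U\<^sup>j(M) = 0\<close> for \<open>j \<ge> 2\<close>, and \<open>Rad\<^sub>U(M)\<close> is the
  socle unless \<open>U\<close> lies in the common kernel \<open>W\<close> of the \<open>\<phi>\<^sub>t\<close>, \<open>t \<in> T\<close>, in which case it is zero. As
  \<open>dim W = r - 1\<close>, the second case never occurs for \<open>dim U = r\<close>, while both occur whenever
  \<open>1 \<le> dim U < r\<close>.\<close>

section \<open>Preliminaries on rings and vector spaces\<close>

text \<open>The obstacle is to control all subspaces of dimension \<open>r\<close> at once while
  every smaller dimension shows two behaviours. This suggests a module whose radical layers register
  a single yes-or-no fact about \<open>U\<close>. A one-dimensional socle achieves this: the first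
  layer consists of values of a bilinear form on \<open>U\<close> and the top with target
  \<open>k\<close>, so no intermediate dimension can occur. \<open>T\<close> starts at
  \<open>r - 1\<close> so that exactly \<open>r - 1\<close> coordinates are left outside it.
  \<open>M\<close> is built without reference to \<open>V\<close>, which enters only through its
  comparison with \<open>Rad / Rad\<^sup>2\<close>. What has to be proved is therefore a duality
  between the coordinates of \<open>E\<close> and that quotient. One half is formal: an additive
  function obeys a Leibniz rule and so vanishes on the square. The other half is a first-order
  Taylor expansion: modulo the square, \<open>a\<close> is \<open>augmentation a\<close> plus a
  combination of the elements \<open>gen i - 1\<close> with the derivations as coefficients. It
  holds on group elements because \<open>g \<mapsto> g - 1\<close> is additive modulo the square,
  and it extends linearly.\<close>

lemma pointwise_abelian_group:
  assumes "abelian_group K"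
    and "carrier M = S \<rightarrow>\<^sub>E carrier K"
    and "\<zero>\<^bsub>M\<^esub> = (\<lambda>i\<in>S. \<zero>\<^bsub>K\<^esub>)"
    and "\<And>f g. f \<oplus>\<^bsub>M\<^esub> g = (\<lambda>i\<in>S. f i \<oplus>\<^bsub>K\<^esub> g i)"
  shows "abelian_group M"
proof -
  interpret K: abelian_group K by fact
  have mem: "f i \<in> carrier K" if "f \<in> S \<rightarrow>\<^sub>E carrier K" "i \<in> S" for f i
    using that by auto
  have ext: "restrict f S = f" if "f \<in> S \<rightarrow>\<^sub>E carrier K" for f
    using that by (rule PiE_restrict)
  show ?thesis
  proof (rule abelian_groupI)
    fix f assume "f \<in> carrier M"
    then have f: "f \<in> S \<rightarrow>\<^sub>E carrier K" by (simp add: assms)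
    show "\<exists>g\<in>carrier M. g \<oplus>\<^bsub>M\<^esub> f = \<zero>\<^bsub>M\<^esub>"
      by (rule bexI[of _ "\<lambda>i\<in>S. \<ominus>\<^bsub>K\<^esub> f i"])
        (auto simp: assms mem[OF f] K.l_neg intro!: restrict_ext)
    have "\<zero>\<^bsub>M\<^esub> \<oplus>\<^bsub>M\<^esub> f = restrict f S"
      by (auto simp: assms mem[OF f] intro!: restrict_ext)
    then show "\<zero>\<^bsub>M\<^esub> \<oplus>\<^bsub>M\<^esub> f = f"
      using ext[OF f] by simp
    fix g assume "g \<in> carrier M"
    then have g: "g \<in> S \<rightarrow>\<^sub>E carrier K" by (simp add: assms)
    show "f \<oplus>\<^bsub>M\<^esub> g \<in> carrier M"
      by (auto simp: assms mem[OF f] mem[OF g])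
    show "f \<oplus>\<^bsub>M\<^esub> g = g \<oplus>\<^bsub>M\<^esub> f"
      by (auto simp: assms mem[OF f] mem[OF g] K.a_comm intro!: restrict_ext)
    fix h assume "h \<in> carrier M"
    then have h: "h \<in> S \<rightarrow>\<^sub>E carrier K" by (simp add: assms)
    show "f \<oplus>\<^bsub>M\<^esub> g \<oplus>\<^bsub>M\<^esub> h = f \<oplus>\<^bsub>M\<^esub> (g \<oplus>\<^bsub>M\<^esub> h)"
      by (auto simp: assms mem[OF f] mem[OF g] mem[OF h] K.a_assoc intro!: restrict_ext)
  qed (simp add: assms)
qed

text \<open>Switching on one coordinate at a time reaches every function on a finite set. The same
  induction shows that the group elements span \<open>kE\<close> and that the unit vectors span the
  module.\<close>

lemma pointwise_induct:
  assumes "abelian_monoid K" and fin: "finite S"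
    and zero: "(\<lambda>i\<in>S. \<zero>\<^bsub>K\<^esub>) \<in> W"
    and step: "\<And>f c j. \<lbrakk>f \<in> W; f \<in> S \<rightarrow>\<^sub>E carrier K; c \<in> carrier K; j \<in> S\<rbrakk> \<Longrightarrow>
      (\<lambda>i\<in>S. f i \<oplus>\<^bsub>K\<^esub> (if i = j then c else \<zero>\<^bsub>K\<^esub>)) \<in> W"
  shows "S \<rightarrow>\<^sub>E carrier K \<subseteq> W"
proof
  interpret K: abelian_monoid K by fact
  fix f assume f: "f \<in> S \<rightarrow>\<^sub>E carrier K"
  then have fS: "i \<in> S \<Longrightarrow> f i \<in> carrier K" for i
    by auto
  have "(\<lambda>i\<in>S. if i \<in> F then f i else \<zero>\<^bsub>K\<^esub>) \<in> W" if "finite F" "F \<subseteq> S" for F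
    using that
  proof (induction F)
    case (insert j F)
    let ?g = "\<lambda>i\<in>S. if i \<in> F then f i else \<zero>\<^bsub>K\<^esub>"
    have "(\<lambda>i\<in>S. ?g i \<oplus>\<^bsub>K\<^esub> (if i = j then f j else \<zero>\<^bsub>K\<^esub>)) \<in> W"
      by (rule step) (use insert f in auto)
    also have "(\<lambda>i\<in>S. ?g i \<oplus>\<^bsub>K\<^esub> (if i = j then f j else \<zero>\<^bsub>K\<^esub>)) =
        (\<lambda>i\<in>S. if i \<in> insert j F then f i else \<zero>\<^bsub>K\<^esub>)"
      using insert fS by (auto simp: fun_eq_iff)
    finally show ?case .
  qed (use zero in simp)
  from this[OF fin order_refl] have "restrict f S \<in> W"
    by (simp cong: restrict_cong)
  then show "f \<in> W"
    using PiE_restrict[OF f] by simp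
qed

section \<open>Characteristic, binomials and nilpotents in rings\<close>

lemma (in ring) add_pow_eq_zero:
  fixes m p :: nat
  assumes "add_pow R p \<one> = \<zero>" "p dvd m" "x \<in> carrier R"
  shows "add_pow R m x = \<zero>"
proof -
  have "add_pow R p x = \<zero>"
    using add_pow_ldistr[of \<one> x p] assms by simp
  moreover obtain k where "m = p * k" using assms(2) by auto
  ultimately show ?thesis
    using add.nat_pow_pow[OF assms(3), of k p] by simp
qed

text \<open>Pascal's rule. Since \<open>u\<close> commutes with \<open>\<one>\<close>, the expansion
  is valid in any ring; it is later used for \<open>u = g - 1\<close> in the group algebra.\<close>

lemma (in ring) binomial_one:
  assumes u: "u \<in> carrier R"
  shows "(u \<oplus> \<one>) [^] (n::nat) = (\<Oplus>k\<in>{..n}. add_pow R (n choose k) (u [^] k))"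
proof (induction n)
  case (Suc n)
  let ?c = "\<lambda>n k. add_pow R (n choose k) (u [^] k)"
  let ?d = "\<lambda>m k. add_pow R (m::nat) (u [^] Suc k)"
  have mul: "(\<Oplus>k\<in>{..n}. ?c n k) \<otimes> u = (\<Oplus>k\<in>{..n}. ?d (n choose k) k)"
    using u by (simp add: finsum_ldistr add_pow_ldistr)
  have "(\<Oplus>k\<in>{..n}. ?d (n choose Suc k) k) \<oplus> ?c n 0 = (\<Oplus>k\<in>{..Suc n}. ?c n k)"
    by (rule finsum_Suc2[symmetric]) (use u in auto)
  \<comment> \<open>The top coefficient \<open>n choose Suc n\<close> is zero, so the shifted sum
    together with the constant term is again the full expansion for the exponent
    \<open>n\<close>.\<close>
  also have "\<dots> = (\<Oplus>k\<in>{..n}. ?c n k)"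
    using u by (subst finsum_Suc) (auto simp: binomial_eq_0)
  finally have low: "(\<Oplus>k\<in>{..n}. ?d (n choose Suc k) k) \<oplus> ?c n 0 = (\<Oplus>k\<in>{..n}. ?c n k)" .
  have "(\<Oplus>k\<in>{..Suc n}. ?c (Suc n) k) =
      (\<Oplus>k\<in>{..n}. ?d (n choose k) k \<oplus> ?d (n choose Suc k) k) \<oplus> ?c n 0"
    using u by (subst finsum_Suc2) (auto simp del: nat_pow_Suc simp: add.nat_pow_mult)
  also have "\<dots> = (\<Oplus>k\<in>{..n}. ?d (n choose k) k) \<oplus>
      ((\<Oplus>k\<in>{..n}. ?d (n choose Suc k) k) \<oplus> ?c n 0)"
    using u by (simp add: finsum_addf a_assoc del: nat_pow_Suc)
  also have "\<dots> = (\<Oplus>k\<in>{..n}. ?c n k) \<otimes> u \<oplus> (\<Oplus>k\<in>{..n}. ?c n k)"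
    by (simp only: mul low)
  also have "\<dots> = (\<Oplus>k\<in>{..n}. ?c n k) \<otimes> (u \<oplus> \<one>)"
    using u by (simp add: r_distr)
  finally show ?case using Suc.IH by simp
qed (use u in simp)

text \<open>All inner binomial coefficients are divisible by \<open>p\<close>, so only the two outer
  terms survive.\<close>

lemma (in ring) power_prime_add_one:
  assumes u: "u \<in> carrier R" and p: "Factorial_Ring.prime (p::nat)" and char: "add_pow R p \<one> = \<zero>"
  shows "(u \<oplus> \<one>) [^] p = u [^] p \<oplus> \<one>"
proof -
  \<comment> \<open>With \<open>p = q + 2\<close> the inner exponents \<open>1, ..., p - 1\<close>
    are exactly \<open>Suc k\<close> for \<open>k \<le> q\<close>.\<close>
  obtain q where q: "p = Suc (Suc q)"
    using prime_ge_2_nat[OF p] by (metis add_2_eq_Suc le_Suc_ex)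
  let ?c = "\<lambda>k. add_pow R (p choose k) (u [^] k)"
  have "(\<Oplus>k\<in>{..q}. ?c (Suc k)) = \<zero>"
  proof (rule add.finprod_one_eqI)
    fix k assume "k \<in> {..q}"
    then have "p dvd p choose Suc k"
      by (intro dvd_choose_prime p) (auto simp: q)
    with add_pow_eq_zero[OF char] u show "?c (Suc k) = \<zero>" by simp
  qed
  then have "(\<Oplus>k\<in>{..Suc q}. ?c k) = \<one>"
    using u by (subst finsum_Suc2) auto
  then have "(\<Oplus>k\<in>{..Suc (Suc q)}. ?c k) = u [^] p \<oplus> \<one>"
    using u by (subst finsum_Suc) (auto simp: q simp del: nat_pow_Suc binomial_Suc_Suc)
  then show ?thesis
    using binomial_one[OF u, of p] by (simp only: q)
qed

lemma (in primeideal) nilpotent_mem: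
  assumes u: "u \<in> carrier R" and nil: "u [^] (m::nat) = \<zero>"
  shows "u \<in> I"
proof -
  have "u \<in> I" if "u [^] k \<in> I" for k :: nat
    using that
  proof (induction k)
    case 0
    then have "\<one> \<in> I" by simp
    with I_notcarr one_imp_carrier show ?case by simp
  next
    case (Suc k)
    then have "u [^] k \<otimes> u \<in> I" by simp
    with I_prime[of "u [^] k" u] u Suc.IH show ?case by blast
  qed
  moreover have "u [^] m \<in> I" using nil by simp
  ultimately show ?thesis .
qed

text \<open>If \<open>p = m k\<close>, then
  \<open>0 = p \<cdot> 1 = (m \<cdot> 1)(k \<cdot> 1)\<close>, and in a domain one of the factors
  must vanish.\<close>

lemma (in domain) characteristic_prime:
  assumes char: "has_characteristic R p" and pos: "p > 0"
  shows "Factorial_Ring.prime p"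
proof -
  have dvd: "p dvd m \<longleftrightarrow> add_pow R m \<one> = \<zero>" for m :: nat
    using char by (simp add: has_characteristic_def)
  show ?thesis
  proof (subst prime_nat_iff, intro conjI allI impI)
    \<comment> \<open>Excludes \<open>p = 1\<close>, which would force
      \<open>\<one> = \<zero>\<close>.\<close>
    have "add_pow R (1::nat) \<one> \<noteq> \<zero>" by simp
    then have "\<not> p dvd 1" using dvd by blast
    then show "1 < p" using pos by (cases "p = 1") auto
    fix m assume "m dvd p"
    then obtain k where k: "p = m * k" by auto
    have "add_pow R m \<one> \<otimes> add_pow R k \<one> = add_pow R m (add_pow R k \<one>)"
      by (simp add: add_pow_ldistr)
    also have "\<dots> = add_pow R p \<one>"
      by (simp add: add.nat_pow_pow k mult.commute)
    also have "\<dots> = \<zero>" using dvd[of p] by simp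
    finally have "add_pow R m \<one> = \<zero> \<or> add_pow R k \<one> = \<zero>"
      by (simp add: integral_iff)
    then have "p dvd m \<or> p dvd k" by (simp only: dvd)
    then show "m = 1 \<or> m = p"
    proof
      assume "p dvd m"
      with \<open>m dvd p\<close> show ?thesis by (simp add: dvd_antisym)
    next
      assume "p dvd k"
      then have "p = k" using k by (simp add: dvd_antisym)
      then show ?thesis using k pos by simp
    qed
  qed
qed

section \<open>Dimension of spans\<close>

context vectorspace
begin

lemma dim_span:
  assumes "finite B" "B \<subseteq> carrier V" "lin_indpt B"
  shows "vectorspace.dim K (vs (span B)) = card B"
proof -
  have sub: "submodule K (span B) V" and BW: "B \<subseteq> span B"
    using assms span_is_submodule in_own_span by auto
  have W: "vectorspace K (vs (span B))"
    by (intro subspace_is_vs span_is_subspace assms)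
  have "vectorspace.basis K (vs (span B)) B"
    unfolding vectorspace.basis_def[OF W]
    using span_li_not_depend[OF BW sub] assms BW by simp
  then show ?thesis
    using vectorspace.dim_basis[OF W assms(1)] by simp
qed

text \<open>An independent subset of \<open>U\<close> stays independent in \<open>span B\<close>, so
  it has at most \<open>card B\<close> elements. Finite dimension of \<open>U\<close> is not given
  in advance; this bound provides a maximal independent set, which is a basis.\<close>

lemma dim_le_card_if_subset_span:
  assumes B: "finite B" "B \<subseteq> carrier V" and U: "VectorSpace.subspace K U V" "U \<subseteq> span B"
  shows "vectorspace.dim K (vs U) \<le> card B"
proof -
  have subU: "submodule K U V"
    using U(1) by simp
  have subW: "submodule K (span B) V" and BW: "B \<subseteq> span B"
    using B span_is_submodule in_own_span by auto
  have W: "vectorspace K (vs (span B))" and vU: "vectorspace K (vs U)"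
    using B U by (auto intro!: subspace_is_vs span_is_subspace)
  interpret W: vectorspace K "vs (span B)" by (rule W)
  interpret U: vectorspace K "vs U" by (rule vU)
  have gen: "W.gen_set B"
    using span_li_not_depend(1)[OF BW subW] by simp
  have fin: "W.fin_dim"
    unfolding W.fin_dim_def using gen B(1) BW by auto
  have dimW: "W.dim \<le> card B"
    using W.gen_ge_dim[OF B(1)] gen BW by simp
  have bound: "finite C \<and> card C \<le> card B" if C: "C \<subseteq> carrier (vs U) \<and> U.lin_indpt C" for C
  proof -
    have "lin_indpt C"
      using C span_li_not_depend(2)[OF _ subU, of C] by simp
    then have "W.lin_indpt C"
      using C U(2) span_li_not_depend(2)[OF _ subW, of C] by auto
    moreover have "C \<subseteq> carrier (vs (span B))"
      using C U(2) by auto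
    ultimately show ?thesis
      using W.li_le_dim[OF fin, of C] dimW by (meson le_trans)
  qed
  have "U.lin_indpt {}"
    by (simp add: U.lin_dep_def)
  then obtain C where "finite C" "maximal C (\<lambda>S. S \<subseteq> carrier (vs U) \<and> U.lin_indpt S)"
    using maximal_exists[of "\<lambda>S. S \<subseteq> carrier (vs U) \<and> U.lin_indpt S" "card B" "{}"] bound by blast
  then have "U.basis C" "finite C"
    using U.max_li_is_basis by auto
  then have "U.dim = card C"
    by (intro U.dim_basis)
  moreover have "card C \<le> card B"
    using \<open>U.basis C\<close> bound[of C] unfolding U.basis_def by blast
  ultimately show ?thesis by simp
qed

lemma submodule_finsum:
  assumes N: "submodule K N V" and f: "\<And>i. i \<in> S \<Longrightarrow> f i \<in> N"
  shows "(\<Oplus>\<^bsub>V\<^esub>i\<in>S. f i) \<in> N"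
proof -
  interpret N: submodule K N V by (rule N)
  show ?thesis
    using f
  proof (induction S rule: infinite_finite_induct)
    case (insert i S)
    have "f i \<in> carrier V" "f \<in> S \<rightarrow> carrier V"
      using insert.prems N.subset by auto
    then show ?case
      using insert by simp
  qed simp_all
qed

end

section \<open>The group algebra of a finite commutative group\<close>

locale group_ring = K: field K + E: comm_group E
  for K :: "('k, 'r) ring_scheme" and E :: "('e, 'g) monoid_scheme" +
  assumes finite_E: "finite (carrier E)"
begin

abbreviation A :: "('k, 'e \<Rightarrow> 'k) module" where
  "A \<equiv> group_algebra K E"

lemma A_simps:
  "carrier A = carrier E \<rightarrow>\<^sub>E carrier K"
  "a \<otimes>\<^bsub>A\<^esub> b = (\<lambda>x\<in>carrier E. \<Oplus>\<^bsub>K\<^esub>y\<in>carrier E. a y \<otimes>\<^bsub>K\<^esub> b (inv\<^bsub>E\<^esub> y \<otimes>\<^bsub>E\<^esub> x))"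
  "\<one>\<^bsub>A\<^esub> = (\<lambda>x\<in>carrier E. if x = \<one>\<^bsub>E\<^esub> then \<one>\<^bsub>K\<^esub> else \<zero>\<^bsub>K\<^esub>)"
  "\<zero>\<^bsub>A\<^esub> = (\<lambda>x\<in>carrier E. \<zero>\<^bsub>K\<^esub>)"
  "a \<oplus>\<^bsub>A\<^esub> b = (\<lambda>x\<in>carrier E. a x \<oplus>\<^bsub>K\<^esub> b x)"
  "c \<odot>\<^bsub>A\<^esub> a = (\<lambda>x\<in>carrier E. c \<otimes>\<^bsub>K\<^esub> a x)"
  by (simp_all add: group_algebra_def)

lemma A_mem: "a \<in> carrier A \<Longrightarrow> x \<in> carrier E \<Longrightarrow> a x \<in> carrier K"
  by (auto simp: A_simps)

lemma A_eqI:
  assumes "a \<in> carrier A" "b \<in> carrier A" "\<And>x. x \<in> carrier E \<Longrightarrow> a x = b x"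
  shows "a = b"
  using assms by (intro PiE_ext[of a "carrier E" "\<lambda>_. carrier K" b]) (simp_all add: A_simps)

section \<open>Linear forms on the group algebra\<close>

text \<open>The linear form on \<open>kE\<close> that extends \<open>h\<close> from the group
  elements. The augmentation, the derivations and each coefficient of a product are of this kind, so
  the manipulations of sums are done once for all of them.\<close>

definition pairing :: "('e \<Rightarrow> 'k) \<Rightarrow> ('e \<Rightarrow> 'k) \<Rightarrow> 'k" where
  "pairing h a = (\<Oplus>\<^bsub>K\<^esub>x\<in>carrier E. h x \<otimes>\<^bsub>K\<^esub> a x)"

lemma pairing_closed [simp]:
  assumes "h \<in> carrier E \<rightarrow> carrier K" "a \<in> carrier A"
  shows "pairing h a \<in> carrier K"
  unfolding pairing_def
  by (rule K.finsum_closed)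
    (use assms A_mem[OF assms(2)] in \<open>auto simp: Pi_iff\<close>)

lemma pairing_cong:
  assumes "h \<in> carrier E \<rightarrow> carrier K" "a \<in> carrier A" "\<And>x. x \<in> carrier E \<Longrightarrow> g x = h x"
  shows "pairing g a = pairing h a"
  unfolding pairing_def
  by (rule K.finsum_cong')
    (use assms A_mem[OF assms(2)] in \<open>auto simp: Pi_iff\<close>)

lemma pairing_add:
  assumes "h \<in> carrier E \<rightarrow> carrier K" "a \<in> carrier A" "b \<in> carrier A"
  shows "pairing h (a \<oplus>\<^bsub>A\<^esub> b) = pairing h a \<oplus>\<^bsub>K\<^esub> pairing h b"
proof -
  have "pairing h (a \<oplus>\<^bsub>A\<^esub> b) = (\<Oplus>\<^bsub>K\<^esub>x\<in>carrier E. h x \<otimes>\<^bsub>K\<^esub> a x \<oplus>\<^bsub>K\<^esub> h x \<otimes>\<^bsub>K\<^esub> b x)"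
    unfolding pairing_def
    by (rule K.finsum_cong')
      (use assms A_mem[OF assms(2)] A_mem[OF assms(3)] in \<open>auto simp: Pi_iff A_simps(5) K.r_distr\<close>)
  also have "\<dots> = pairing h a \<oplus>\<^bsub>K\<^esub> pairing h b"
    unfolding pairing_def
    by (rule K.finsum_addf)
      (use assms A_mem[OF assms(2)] A_mem[OF assms(3)] in \<open>auto simp: Pi_iff\<close>)
  finally show ?thesis .
qed

lemma pairing_add_left:
  assumes "g \<in> carrier E \<rightarrow> carrier K" "h \<in> carrier E \<rightarrow> carrier K" "a \<in> carrier A"
  shows "pairing (\<lambda>x. g x \<oplus>\<^bsub>K\<^esub> h x) a = pairing g a \<oplus>\<^bsub>K\<^esub> pairing h a"
proof -
  have "pairing (\<lambda>x. g x \<oplus>\<^bsub>K\<^esub> h x) a = (\<Oplus>\<^bsub>K\<^esub>x\<in>carrier E. g x \<otimes>\<^bsub>K\<^esub> a x \<oplus>\<^bsub>K\<^esub> h x \<otimes>\<^bsub>K\<^esub> a x)"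
    unfolding pairing_def
    by (rule K.finsum_cong') (use assms A_mem[OF assms(3)] in \<open>auto simp: Pi_iff K.l_distr\<close>)
  also have "\<dots> = pairing g a \<oplus>\<^bsub>K\<^esub> pairing h a"
    unfolding pairing_def
    by (rule K.finsum_addf)
      (use assms A_mem[OF assms(3)] in \<open>auto simp: Pi_iff\<close>)
  finally show ?thesis .
qed

lemma pairing_smult:
  assumes "h \<in> carrier E \<rightarrow> carrier K" "a \<in> carrier A" "c \<in> carrier K"
  shows "pairing h (c \<odot>\<^bsub>A\<^esub> a) = c \<otimes>\<^bsub>K\<^esub> pairing h a"
proof -
  have "pairing h (c \<odot>\<^bsub>A\<^esub> a) = (\<Oplus>\<^bsub>K\<^esub>x\<in>carrier E. c \<otimes>\<^bsub>K\<^esub> (h x \<otimes>\<^bsub>K\<^esub> a x))"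
    unfolding pairing_def
    by (rule K.finsum_cong')
      (use assms A_mem[OF assms(2)] in \<open>auto simp: Pi_iff A_simps(6) K.m_lcomm\<close>)
  also have "\<dots> = c \<otimes>\<^bsub>K\<^esub> pairing h a"
    unfolding pairing_def
    by (rule K.finsum_rdistr[symmetric])
      (use assms A_mem[OF assms(2)] finite_E in \<open>auto simp: Pi_iff\<close>)
  finally show ?thesis .
qed

lemma pairing_const:
  assumes "h \<in> carrier E \<rightarrow> carrier K" "a \<in> carrier A" "c \<in> carrier K"
  shows "pairing (\<lambda>x. c \<otimes>\<^bsub>K\<^esub> h x) a = c \<otimes>\<^bsub>K\<^esub> pairing h a"
proof -
  have "pairing (\<lambda>x. c \<otimes>\<^bsub>K\<^esub> h x) a = (\<Oplus>\<^bsub>K\<^esub>x\<in>carrier E. c \<otimes>\<^bsub>K\<^esub> (h x \<otimes>\<^bsub>K\<^esub> a x))"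
    unfolding pairing_def
    by (rule K.finsum_cong') (use assms A_mem[OF assms(2)] in \<open>auto simp: Pi_iff K.m_assoc\<close>)
  also have "\<dots> = c \<otimes>\<^bsub>K\<^esub> pairing h a"
    unfolding pairing_def
    by (rule K.finsum_rdistr[symmetric])
      (use assms A_mem[OF assms(2)] finite_E in \<open>auto simp: Pi_iff\<close>)
  finally show ?thesis .
qed

section \<open>The convolution product\<close>

lemma A_mult_closed:
  assumes "a \<in> carrier A" "b \<in> carrier A"
  shows "a \<otimes>\<^bsub>A\<^esub> b \<in> carrier A"
  using A_mem[OF assms(1)] A_mem[OF assms(2)] unfolding A_simps(1,2)
  by (auto intro!: K.finsum_closed K.m_closed)

lemma sum_translate:
  assumes "y \<in> carrier E" "f \<in> carrier E \<rightarrow> carrier K"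
  shows "(\<Oplus>\<^bsub>K\<^esub>x\<in>carrier E. f x) = (\<Oplus>\<^bsub>K\<^esub>z\<in>carrier E. f (y \<otimes>\<^bsub>E\<^esub> z))"
proof -
  have im: "(\<lambda>z. y \<otimes>\<^bsub>E\<^esub> z) ` carrier E = carrier E"
    using E.surj_const_mult[OF assms(1)] by simp
  have "inj_on (\<lambda>z. y \<otimes>\<^bsub>E\<^esub> z) (carrier E)"
    using assms(1) by (auto simp: inj_on_def)
  with K.finsum_reindex[of f "\<lambda>z. y \<otimes>\<^bsub>E\<^esub> z" "carrier E"] assms show ?thesis
    by (simp add: im)
qed

text \<open>The substitution \<open>x = y z\<close> in the double sum makes \<open>h\<close> appear
  at products of group elements. Associativity, multiplicativity of the augmentation and the Leibniz
  rule all follow by inserting the behaviour of a particular \<open>h\<close> at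
  \<open>y z\<close>.\<close>

lemma pairing_mult:
  assumes h: "h \<in> carrier E \<rightarrow> carrier K" and a: "a \<in> carrier A" and b: "b \<in> carrier A"
  shows "pairing h (a \<otimes>\<^bsub>A\<^esub> b) =
    (\<Oplus>\<^bsub>K\<^esub>y\<in>carrier E. a y \<otimes>\<^bsub>K\<^esub> pairing (\<lambda>z. h (y \<otimes>\<^bsub>E\<^esub> z)) b)"
proof -
  let ?g = "\<lambda>x y. h x \<otimes>\<^bsub>K\<^esub> (a y \<otimes>\<^bsub>K\<^esub> b (inv\<^bsub>E\<^esub> y \<otimes>\<^bsub>E\<^esub> x))"
  have hx: "x \<in> carrier E \<Longrightarrow> h x \<in> carrier K" for x
    using h by auto
  have "pairing h (a \<otimes>\<^bsub>A\<^esub> b) = (\<Oplus>\<^bsub>K\<^esub>x\<in>carrier E. \<Oplus>\<^bsub>K\<^esub>y\<in>carrier E. ?g x y)"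
    unfolding pairing_def
  proof (rule K.finsum_cong')
    fix x assume x: "x \<in> carrier E"
    show "h x \<otimes>\<^bsub>K\<^esub> (a \<otimes>\<^bsub>A\<^esub> b) x = (\<Oplus>\<^bsub>K\<^esub>y\<in>carrier E. ?g x y)"
      using x a b A_mem[OF a] A_mem[OF b] hx finite_E by (simp add: A_simps(2) K.finsum_rdistr)
  qed (use a b A_mem[OF a] A_mem[OF b] hx in \<open>auto intro!: K.finsum_closed\<close>)
  also have "\<dots> = (\<Oplus>\<^bsub>K\<^esub>y\<in>carrier E. \<Oplus>\<^bsub>K\<^esub>x\<in>carrier E. ?g x y)"
    by (rule K.finsum_finsum_swap) (use a b A_mem[OF a] A_mem[OF b] hx finite_E in auto)
  also have "\<dots> = (\<Oplus>\<^bsub>K\<^esub>y\<in>carrier E. a y \<otimes>\<^bsub>K\<^esub> pairing (\<lambda>z. h (y \<otimes>\<^bsub>E\<^esub> z)) b)"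
  proof (rule K.finsum_cong')
    fix y assume y: "y \<in> carrier E"
    have "(\<Oplus>\<^bsub>K\<^esub>x\<in>carrier E. ?g x y) = (\<Oplus>\<^bsub>K\<^esub>z\<in>carrier E. ?g (y \<otimes>\<^bsub>E\<^esub> z) y)"
      by (rule sum_translate) (use y a b A_mem[OF a] A_mem[OF b] hx in auto)
    also have "\<dots> = (\<Oplus>\<^bsub>K\<^esub>z\<in>carrier E. a y \<otimes>\<^bsub>K\<^esub> (h (y \<otimes>\<^bsub>E\<^esub> z) \<otimes>\<^bsub>K\<^esub> b z))"
      by (rule K.finsum_cong')
        (use y a b A_mem[OF a] A_mem[OF b] hx in \<open>auto simp: K.m_lcomm E.m_assoc[symmetric]\<close>)
    also have "\<dots> = a y \<otimes>\<^bsub>K\<^esub> pairing (\<lambda>z. h (y \<otimes>\<^bsub>E\<^esub> z)) b"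
      unfolding pairing_def
      by (rule K.finsum_rdistr[symmetric]) (use y a b A_mem[OF a] A_mem[OF b] hx finite_E in auto)
    finally show "(\<Oplus>\<^bsub>K\<^esub>x\<in>carrier E. ?g x y) = a y \<otimes>\<^bsub>K\<^esub> pairing (\<lambda>z. h (y \<otimes>\<^bsub>E\<^esub> z)) b" .
  qed (use a b A_mem[OF a] A_mem[OF b] hx in \<open>auto intro!: K.m_closed pairing_closed\<close>)
  finally show ?thesis .
qed

lemma sum_eq_pairing:
  assumes "h \<in> carrier E \<rightarrow> carrier K" "a \<in> carrier A"
  shows "(\<Oplus>\<^bsub>K\<^esub>y\<in>carrier E. a y \<otimes>\<^bsub>K\<^esub> h y) = pairing h a"
  unfolding pairing_def
  by (rule K.finsum_cong') (use assms A_mem[OF assms(2)] in \<open>auto simp: Pi_iff K.m_comm\<close>)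

text \<open>With a coefficient of the product written as a linear form in \<open>a\<close>,
  distributivity and compatibility with scalars reduce to linearity of
  \<open>pairing\<close>.\<close>

lemma A_mult_eq_pairing:
  assumes "a \<in> carrier A" "b \<in> carrier A" "x \<in> carrier E"
  shows "(a \<otimes>\<^bsub>A\<^esub> b) x = pairing (\<lambda>y. b (inv\<^bsub>E\<^esub> y \<otimes>\<^bsub>E\<^esub> x)) a"
  using assms A_mem[OF assms(1)] A_mem[OF assms(2)] by (subst sum_eq_pairing[symmetric]) (auto simp: A_simps(2))

lemma A_mult_assoc:
  assumes a: "a \<in> carrier A" and b: "b \<in> carrier A" and c: "c \<in> carrier A"
  shows "(a \<otimes>\<^bsub>A\<^esub> b) \<otimes>\<^bsub>A\<^esub> c = a \<otimes>\<^bsub>A\<^esub> (b \<otimes>\<^bsub>A\<^esub> c)"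
proof (rule A_eqI)
  fix x assume x: "x \<in> carrier E"
  \<comment> \<open>The coefficient at \<open>x\<close> is the form given by
    \<open>\<lambda>w. c (inv w \<otimes> x)\<close>, evaluated at the product of \<open>a\<close>
    and \<open>b\<close>.\<close>
  have "((a \<otimes>\<^bsub>A\<^esub> b) \<otimes>\<^bsub>A\<^esub> c) x =
      (\<Oplus>\<^bsub>K\<^esub>y\<in>carrier E. a y \<otimes>\<^bsub>K\<^esub> pairing (\<lambda>z. c (inv\<^bsub>E\<^esub> (y \<otimes>\<^bsub>E\<^esub> z) \<otimes>\<^bsub>E\<^esub> x)) b)"
    using a b c x A_mem[OF c] by (simp add: A_mult_eq_pairing A_mult_closed pairing_mult)
  also have "\<dots> = (\<Oplus>\<^bsub>K\<^esub>y\<in>carrier E. a y \<otimes>\<^bsub>K\<^esub> (b \<otimes>\<^bsub>A\<^esub> c) (inv\<^bsub>E\<^esub> y \<otimes>\<^bsub>E\<^esub> x))"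
  proof (rule K.finsum_cong')
    fix y assume y: "y \<in> carrier E"
    have "(b \<otimes>\<^bsub>A\<^esub> c) (inv\<^bsub>E\<^esub> y \<otimes>\<^bsub>E\<^esub> x) =
        pairing (\<lambda>z. c (inv\<^bsub>E\<^esub> z \<otimes>\<^bsub>E\<^esub> (inv\<^bsub>E\<^esub> y \<otimes>\<^bsub>E\<^esub> x))) b"
      using b c x y by (simp add: A_mult_eq_pairing)
    also have "\<dots> = pairing (\<lambda>z. c (inv\<^bsub>E\<^esub> (y \<otimes>\<^bsub>E\<^esub> z) \<otimes>\<^bsub>E\<^esub> x)) b"
      by (rule pairing_cong)
        (use b c x y A_mem[OF a] A_mem[OF b] A_mem[OF c] in \<open>auto simp: E.inv_mult_group E.m_assoc\<close>)
    finally show "a y \<otimes>\<^bsub>K\<^esub> pairing (\<lambda>z. c (inv\<^bsub>E\<^esub> (y \<otimes>\<^bsub>E\<^esub> z) \<otimes>\<^bsub>E\<^esub> x)) b =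
        a y \<otimes>\<^bsub>K\<^esub> (b \<otimes>\<^bsub>A\<^esub> c) (inv\<^bsub>E\<^esub> y \<otimes>\<^bsub>E\<^esub> x)" by simp
  qed (use x A_mem[OF a] A_mem[OF b] A_mem[OF c] A_mem[OF A_mult_closed[OF b c]] in auto)
  also have "\<dots> = (a \<otimes>\<^bsub>A\<^esub> (b \<otimes>\<^bsub>A\<^esub> c)) x"
    using x by (simp add: A_simps(2)[of a])
  finally show "((a \<otimes>\<^bsub>A\<^esub> b) \<otimes>\<^bsub>A\<^esub> c) x = (a \<otimes>\<^bsub>A\<^esub> (b \<otimes>\<^bsub>A\<^esub> c)) x" .
qed (use a b c A_mem[OF a] A_mem[OF b] A_mem[OF c] A_mult_closed in auto)

text \<open>Because \<open>E\<close> is commutative, the substitution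
  \<open>y \<mapsto> x \<otimes> inv y\<close> interchanges the arguments of the two
  factors.\<close>

lemma A_mult_comm:
  assumes a: "a \<in> carrier A" and b: "b \<in> carrier A"
  shows "a \<otimes>\<^bsub>A\<^esub> b = b \<otimes>\<^bsub>A\<^esub> a"
proof (rule A_eqI)
  fix x assume x: "x \<in> carrier E"
  let ?f = "\<lambda>y. a y \<otimes>\<^bsub>K\<^esub> b (inv\<^bsub>E\<^esub> y \<otimes>\<^bsub>E\<^esub> x)"
  have im: "(\<lambda>y. x \<otimes>\<^bsub>E\<^esub> inv\<^bsub>E\<^esub> y) ` carrier E = carrier E"
  proof
    show "carrier E \<subseteq> (\<lambda>y. x \<otimes>\<^bsub>E\<^esub> inv\<^bsub>E\<^esub> y) ` carrier E"
    proof
      fix y assume y: "y \<in> carrier E"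
      with x have "y = x \<otimes>\<^bsub>E\<^esub> inv\<^bsub>E\<^esub> (inv\<^bsub>E\<^esub> y \<otimes>\<^bsub>E\<^esub> x)"
        by (simp add: E.inv_mult_group E.m_assoc[symmetric])
      with x y show "y \<in> (\<lambda>y. x \<otimes>\<^bsub>E\<^esub> inv\<^bsub>E\<^esub> y) ` carrier E" by blast
    qed
  qed (use x A_mem[OF a] A_mem[OF b] in auto)
  \<comment> \<open>A map of the finite set \<open>carrier E\<close> onto itself is
    injective.\<close>
  have inj: "inj_on (\<lambda>y. x \<otimes>\<^bsub>E\<^esub> inv\<^bsub>E\<^esub> y) (carrier E)"
    using im finite_E by (metis eq_card_imp_inj_on)
  have "(a \<otimes>\<^bsub>A\<^esub> b) x = (\<Oplus>\<^bsub>K\<^esub>y\<in>(\<lambda>y. x \<otimes>\<^bsub>E\<^esub> inv\<^bsub>E\<^esub> y) ` carrier E. ?f y)"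
    using x by (simp add: A_simps(2) im)
  also have "\<dots> = (\<Oplus>\<^bsub>K\<^esub>y\<in>carrier E. ?f (x \<otimes>\<^bsub>E\<^esub> inv\<^bsub>E\<^esub> y))"
    by (rule K.finsum_reindex) (use a b x A_mem[OF a] A_mem[OF b] inj in auto)
  also have "\<dots> = (\<Oplus>\<^bsub>K\<^esub>y\<in>carrier E. b y \<otimes>\<^bsub>K\<^esub> a (inv\<^bsub>E\<^esub> y \<otimes>\<^bsub>E\<^esub> x))"
  proof (rule K.finsum_cong')
    fix y assume y: "y \<in> carrier E"
    have "inv\<^bsub>E\<^esub> (x \<otimes>\<^bsub>E\<^esub> inv\<^bsub>E\<^esub> y) \<otimes>\<^bsub>E\<^esub> x = y"
      using x y by (simp add: E.inv_mult_group E.m_assoc)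
    then show "?f (x \<otimes>\<^bsub>E\<^esub> inv\<^bsub>E\<^esub> y) = b y \<otimes>\<^bsub>K\<^esub> a (inv\<^bsub>E\<^esub> y \<otimes>\<^bsub>E\<^esub> x)"
      using a b x y A_mem[OF a] A_mem[OF b] by (simp add: K.m_comm E.m_comm)
  qed (use a b x A_mem[OF a] A_mem[OF b] in auto)
  also have "\<dots> = (b \<otimes>\<^bsub>A\<^esub> a) x"
    using x by (simp add: A_simps(2))
  finally show "(a \<otimes>\<^bsub>A\<^esub> b) x = (b \<otimes>\<^bsub>A\<^esub> a) x" .
qed (use a b A_mem[OF a] A_mem[OF b] A_mult_closed in auto)

section \<open>Group elements as a basis, and the algebra structure\<close>

text \<open>The group element \<open>g\<close> as a basis vector of \<open>kE\<close>.\<close>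

definition single :: "'e \<Rightarrow> 'e \<Rightarrow> 'k" where
  "single g = (\<lambda>x\<in>carrier E. if x = g then \<one>\<^bsub>K\<^esub> else \<zero>\<^bsub>K\<^esub>)"

lemma one_A: "\<one>\<^bsub>A\<^esub> = single \<one>\<^bsub>E\<^esub>"
  by (simp add: single_def A_simps)

lemma single_closed [simp]: "single g \<in> carrier A"
  by (auto simp: single_def A_simps)

lemma pairing_single:
  assumes "h \<in> carrier E \<rightarrow> carrier K" "g \<in> carrier E"
  shows "pairing h (single g) = h g"
proof -
  have "pairing h (single g) = (\<Oplus>\<^bsub>K\<^esub>x\<in>carrier E. if g = x then h x else \<zero>\<^bsub>K\<^esub>)"
    unfolding pairing_def single_def
    by (rule K.finsum_cong') (use assms in \<open>auto simp: Pi_iff\<close>)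
  also have "\<dots> = h g"
    by (rule K.finsum_singleton) (use assms finite_E in auto)
  finally show ?thesis .
qed

lemma single_mult_apply:
  assumes "g \<in> carrier E" "b \<in> carrier A" "x \<in> carrier E"
  shows "(single g \<otimes>\<^bsub>A\<^esub> b) x = b (inv\<^bsub>E\<^esub> g \<otimes>\<^bsub>E\<^esub> x)"
  using assms A_mem[OF assms(2)] by (simp add: A_mult_eq_pairing pairing_single)

lemma single_mult_single:
  assumes "g \<in> carrier E" "h \<in> carrier E"
  shows "single g \<otimes>\<^bsub>A\<^esub> single h = single (g \<otimes>\<^bsub>E\<^esub> h)"
proof (rule A_eqI)
  fix x assume x: "x \<in> carrier E"
  have "inv\<^bsub>E\<^esub> g \<otimes>\<^bsub>E\<^esub> x = h \<longleftrightarrow> x = g \<otimes>\<^bsub>E\<^esub> h"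
    using assms x by (metis E.inv_solve_left)
  then show "(single g \<otimes>\<^bsub>A\<^esub> single h) x = single (g \<otimes>\<^bsub>E\<^esub> h) x"
    using assms x by (simp add: single_mult_apply) (simp add: single_def)
qed (use assms A_mult_closed in auto)

lemma abelian_group_A: "abelian_group A"
  by (rule pointwise_abelian_group[OF K.abelian_group_axioms]) (simp_all add: A_simps)

lemma cring_A: "cring A"
proof (rule cringI[OF abelian_group_A])
  show "comm_monoid A"
  proof (rule comm_monoidI)
    fix a assume a: "a \<in> carrier A"
    show "\<one>\<^bsub>A\<^esub> \<otimes>\<^bsub>A\<^esub> a = a"
      by (rule A_eqI) (simp_all add: a A_mult_closed one_A single_mult_apply)
  qed (rule A_mult_closed A_mult_assoc A_mult_comm; assumption | simp add: one_A)+
next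
  fix a b c assume abc: "a \<in> carrier A" "b \<in> carrier A" "c \<in> carrier A"
  have closed: "u \<oplus>\<^bsub>A\<^esub> v \<in> carrier A" if "u \<in> carrier A" "v \<in> carrier A" for u v
    using that abelian_group_A by (metis abelian_group.axioms(1) abelian_monoid.a_closed)
  show "(a \<oplus>\<^bsub>A\<^esub> b) \<otimes>\<^bsub>A\<^esub> c = a \<otimes>\<^bsub>A\<^esub> c \<oplus>\<^bsub>A\<^esub> b \<otimes>\<^bsub>A\<^esub> c"
  proof (rule A_eqI)
    fix x assume x: "x \<in> carrier E"
    have "((a \<oplus>\<^bsub>A\<^esub> b) \<otimes>\<^bsub>A\<^esub> c) x = (a \<otimes>\<^bsub>A\<^esub> c) x \<oplus>\<^bsub>K\<^esub> (b \<otimes>\<^bsub>A\<^esub> c) x"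
      using abc x closed A_mem[OF abc(3)] by (simp add: A_mult_eq_pairing pairing_add Pi_iff)
    then show "((a \<oplus>\<^bsub>A\<^esub> b) \<otimes>\<^bsub>A\<^esub> c) x = (a \<otimes>\<^bsub>A\<^esub> c \<oplus>\<^bsub>A\<^esub> b \<otimes>\<^bsub>A\<^esub> c) x"
      using x by (simp add: A_simps(5))
  qed (simp_all add: abc closed A_mult_closed)
qed

sublocale A: cring A by (rule cring_A)

lemma smult_closed:
  assumes "c \<in> carrier K" "a \<in> carrier A"
  shows "c \<odot>\<^bsub>A\<^esub> a \<in> carrier A"
  using assms(1) A_mem[OF assms(2)] unfolding A_simps(1,6) by simp

lemma vectorspace_A: "vectorspace K A"
proof -
  have "Module.module K A"
  proof (rule moduleI[OF K.cring_axioms abelian_group_A])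
    fix c d a b assume c: "c \<in> carrier K" and d: "d \<in> carrier K" and a: "a \<in> carrier A" and b: "b \<in> carrier A"
    note cl = smult_closed A.a_closed K.a_closed K.m_closed a b c d
    show "(c \<oplus>\<^bsub>K\<^esub> d) \<odot>\<^bsub>A\<^esub> a = c \<odot>\<^bsub>A\<^esub> a \<oplus>\<^bsub>A\<^esub> d \<odot>\<^bsub>A\<^esub> a"
      by (rule A_eqI) (simp_all add: cl, simp add: A_simps(5,6) K.l_distr c d A_mem[OF a])
    show "c \<odot>\<^bsub>A\<^esub> (a \<oplus>\<^bsub>A\<^esub> b) = c \<odot>\<^bsub>A\<^esub> a \<oplus>\<^bsub>A\<^esub> c \<odot>\<^bsub>A\<^esub> b"
      by (rule A_eqI) (simp_all add: cl, simp add: A_simps(5,6) K.r_distr c A_mem[OF a] A_mem[OF b])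
    show "(c \<otimes>\<^bsub>K\<^esub> d) \<odot>\<^bsub>A\<^esub> a = c \<odot>\<^bsub>A\<^esub> (d \<odot>\<^bsub>A\<^esub> a)"
      by (rule A_eqI) (simp_all add: cl, simp add: A_simps(6) K.m_assoc c d A_mem[OF a])
  next
    fix a assume a: "a \<in> carrier A"
    show "\<one>\<^bsub>K\<^esub> \<odot>\<^bsub>A\<^esub> a = a"
      by (rule A_eqI) (simp_all add: smult_closed a, simp add: A_simps(6) A_mem[OF a])
  qed (rule smult_closed)
  then show ?thesis
    by (rule vectorspace.intro) (rule K.field_axioms)
qed

sublocale AV: vectorspace K A
  by (rule vectorspace_A)

lemma smult_mult:
  assumes c: "c \<in> carrier K" and a: "a \<in> carrier A" and b: "b \<in> carrier A"
  shows "c \<odot>\<^bsub>A\<^esub> (a \<otimes>\<^bsub>A\<^esub> b) = (c \<odot>\<^bsub>A\<^esub> a) \<otimes>\<^bsub>A\<^esub> b"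
proof (rule A_eqI)
  fix x assume x: "x \<in> carrier E"
  have "\<And>y. y \<in> carrier E \<Longrightarrow> b (inv\<^bsub>E\<^esub> y \<otimes>\<^bsub>E\<^esub> x) \<in> carrier K"
    using A_mem[OF b] x by simp
  then have "((c \<odot>\<^bsub>A\<^esub> a) \<otimes>\<^bsub>A\<^esub> b) x = c \<otimes>\<^bsub>K\<^esub> (a \<otimes>\<^bsub>A\<^esub> b) x"
    using a b c x by (simp add: A_mult_eq_pairing smult_closed pairing_smult Pi_iff)
  then show "(c \<odot>\<^bsub>A\<^esub> (a \<otimes>\<^bsub>A\<^esub> b)) x = ((c \<odot>\<^bsub>A\<^esub> a) \<otimes>\<^bsub>A\<^esub> b) x"
    using x by (simp add: A_simps(6))
qed (simp_all add: smult_closed a b c)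

lemma smult_eq_mult: "c \<in> carrier K \<Longrightarrow> a \<in> carrier A \<Longrightarrow> c \<odot>\<^bsub>A\<^esub> a = (c \<odot>\<^bsub>A\<^esub> \<one>\<^bsub>A\<^esub>) \<otimes>\<^bsub>A\<^esub> a"
  by (simp add: smult_mult[symmetric])

text \<open>A scalar \<open>c\<close> acts as multiplication by the ring element
  \<open>c \<cdot> 1\<close>, so every ideal is a subspace.\<close>

lemma ideal_smult_closed:
  assumes "ideal N A" "c \<in> carrier K" "a \<in> N"
  shows "c \<odot>\<^bsub>A\<^esub> a \<in> N"
proof -
  have "a \<in> carrier A" using ideal.Icarr assms(1,3) by fast
  then show ?thesis
    using ideal.I_l_closed[OF assms(1,3) smult_closed[OF assms(2) A.one_closed]]
    by (simp only: smult_eq_mult[OF assms(2)])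
qed

lemma A_induct:
  assumes zero: "\<zero>\<^bsub>A\<^esub> \<in> W"
    and add: "\<And>a b. \<lbrakk>a \<in> W; b \<in> W; a \<in> carrier A; b \<in> carrier A\<rbrakk> \<Longrightarrow> a \<oplus>\<^bsub>A\<^esub> b \<in> W"
    and single: "\<And>c g. \<lbrakk>c \<in> carrier K; g \<in> carrier E\<rbrakk> \<Longrightarrow> c \<odot>\<^bsub>A\<^esub> single g \<in> W"
  shows "carrier A \<subseteq> W"
  unfolding A_simps(1)
proof (rule pointwise_induct[OF K.abelian_monoid_axioms finite_E])
  fix f c g
  assume f: "f \<in> W" "f \<in> carrier E \<rightarrow>\<^sub>E carrier K" and c: "c \<in> carrier K" and g: "g \<in> carrier E"
  have "f \<oplus>\<^bsub>A\<^esub> (c \<odot>\<^bsub>A\<^esub> single g) \<in> W"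
    using f c g by (intro add single smult_closed single_closed) (simp_all add: A_simps(1))
  also have "f \<oplus>\<^bsub>A\<^esub> (c \<odot>\<^bsub>A\<^esub> single g) = (\<lambda>x\<in>carrier E. f x \<oplus>\<^bsub>K\<^esub> (if x = g then c else \<zero>\<^bsub>K\<^esub>))"
    using c by (auto simp: A_simps(5,6) single_def intro!: restrict_ext)
  finally show "(\<lambda>x\<in>carrier E. f x \<oplus>\<^bsub>K\<^esub> (if x = g then c else \<zero>\<^bsub>K\<^esub>)) \<in> W" .
qed (use zero in \<open>simp add: A_simps(4)\<close>)

text \<open>\<open>N\<close> is a subspace and the group elements span \<open>kE\<close>, so a
  congruence between linear maps can be checked on group elements. It is applied to
  \<open>L a = augmentation a \<cdot> 1\<close> modulo a maximal ideal and to the first-order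
  expansion modulo the square of the augmentation ideal.\<close>

lemma ideal_congruence_from_singles:
  assumes N: "ideal N A"
    and L: "L \<in> carrier A \<rightarrow> carrier A"
    and L_add: "\<And>a b. \<lbrakk>a \<in> carrier A; b \<in> carrier A\<rbrakk> \<Longrightarrow> L (a \<oplus>\<^bsub>A\<^esub> b) = L a \<oplus>\<^bsub>A\<^esub> L b"
    and L_smult: "\<And>c a. \<lbrakk>c \<in> carrier K; a \<in> carrier A\<rbrakk> \<Longrightarrow> L (c \<odot>\<^bsub>A\<^esub> a) = c \<odot>\<^bsub>A\<^esub> L a"
    and singles: "\<And>g. g \<in> carrier E \<Longrightarrow> single g \<ominus>\<^bsub>A\<^esub> L (single g) \<in> N"
    and a: "a \<in> carrier A"
  shows "a \<ominus>\<^bsub>A\<^esub> L a \<in> N"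
proof -
  interpret N: ideal N A by fact
  have cl: "L a \<in> carrier A" if "a \<in> carrier A" for a
    using L that by auto
  have "carrier A \<subseteq> {a \<in> carrier A. a \<ominus>\<^bsub>A\<^esub> L a \<in> N}"
  proof (rule A_induct)
    have "L (\<zero>\<^bsub>K\<^esub> \<odot>\<^bsub>A\<^esub> \<zero>\<^bsub>A\<^esub>) = \<zero>\<^bsub>K\<^esub> \<odot>\<^bsub>A\<^esub> L \<zero>\<^bsub>A\<^esub>"
      by (rule L_smult) auto
    then have "L \<zero>\<^bsub>A\<^esub> = \<zero>\<^bsub>A\<^esub>"
      using cl[of "\<zero>\<^bsub>A\<^esub>"] by simp
    then show "\<zero>\<^bsub>A\<^esub> \<in> {a \<in> carrier A. a \<ominus>\<^bsub>A\<^esub> L a \<in> N}"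
      by (simp add: A.minus_eq)
  next
    fix a b
    assume ab: "a \<in> {a \<in> carrier A. a \<ominus>\<^bsub>A\<^esub> L a \<in> N}" "b \<in> {a \<in> carrier A. a \<ominus>\<^bsub>A\<^esub> L a \<in> N}"
    then have "a \<oplus>\<^bsub>A\<^esub> b \<ominus>\<^bsub>A\<^esub> L (a \<oplus>\<^bsub>A\<^esub> b) = (a \<ominus>\<^bsub>A\<^esub> L a) \<oplus>\<^bsub>A\<^esub> (b \<ominus>\<^bsub>A\<^esub> L b)"
      using cl by (simp add: L_add A.minus_eq A.minus_add A.a_ac)
    with ab show "a \<oplus>\<^bsub>A\<^esub> b \<in> {a \<in> carrier A. a \<ominus>\<^bsub>A\<^esub> L a \<in> N}"
      by auto
  next
    fix c g assume c: "c \<in> carrier K" and g: "g \<in> carrier E"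
    have "c \<odot>\<^bsub>A\<^esub> single g \<ominus>\<^bsub>A\<^esub> L (c \<odot>\<^bsub>A\<^esub> single g) = c \<odot>\<^bsub>A\<^esub> (single g \<ominus>\<^bsub>A\<^esub> L (single g))"
      using c cl by (simp add: L_smult A.minus_eq AV.smult_r_distr AV.smult_r_minus)
    then show "c \<odot>\<^bsub>A\<^esub> single g \<in> {a \<in> carrier A. a \<ominus>\<^bsub>A\<^esub> L a \<in> N}"
      using c ideal_smult_closed[OF N c singles[OF g]] by (simp add: smult_closed)
  qed
  with a show ?thesis by auto
qed

lemma pairing_diff:
  assumes "h \<in> carrier E \<rightarrow> carrier K" "a \<in> carrier A" "b \<in> carrier A"
  shows "pairing h (a \<ominus>\<^bsub>A\<^esub> b) = pairing h a \<ominus>\<^bsub>K\<^esub> pairing h b"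
proof -
  have "(a \<ominus>\<^bsub>A\<^esub> b) \<oplus>\<^bsub>A\<^esub> b = a"
    using assms by (simp add: A.minus_eq A.a_assoc A.l_neg)
  then have "pairing h a = pairing h (a \<ominus>\<^bsub>A\<^esub> b) \<oplus>\<^bsub>K\<^esub> pairing h b"
    using pairing_add[OF assms(1), of "a \<ominus>\<^bsub>A\<^esub> b" b] assms by simp
  then show ?thesis
    using assms by (simp add: K.minus_eq K.a_assoc K.r_neg)
qed

section \<open>The augmentation and the Jacobson radical\<close>

definition augmentation :: "('e \<Rightarrow> 'k) \<Rightarrow> 'k" where
  "augmentation = pairing (\<lambda>_. \<one>\<^bsub>K\<^esub>)"

lemma augmentation_closed [simp]: "a \<in> carrier A \<Longrightarrow> augmentation a \<in> carrier K"
  by (simp add: augmentation_def)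

lemma augmentation_add:
  "\<lbrakk>a \<in> carrier A; b \<in> carrier A\<rbrakk> \<Longrightarrow> augmentation (a \<oplus>\<^bsub>A\<^esub> b) = augmentation a \<oplus>\<^bsub>K\<^esub> augmentation b"
  by (simp add: augmentation_def pairing_add)

lemma augmentation_diff:
  "\<lbrakk>a \<in> carrier A; b \<in> carrier A\<rbrakk> \<Longrightarrow> augmentation (a \<ominus>\<^bsub>A\<^esub> b) = augmentation a \<ominus>\<^bsub>K\<^esub> augmentation b"
  by (simp add: augmentation_def pairing_diff)

lemma augmentation_smult:
  "\<lbrakk>c \<in> carrier K; a \<in> carrier A\<rbrakk> \<Longrightarrow> augmentation (c \<odot>\<^bsub>A\<^esub> a) = c \<otimes>\<^bsub>K\<^esub> augmentation a"
  by (simp add: augmentation_def pairing_smult)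

text \<open>For the constant function one, the inner form in \<open>pairing_mult\<close> is
  \<open>augmentation b\<close> for every \<open>y\<close> and can be taken out of the sum.\<close>

lemma augmentation_mult:
  assumes "a \<in> carrier A" "b \<in> carrier A"
  shows "augmentation (a \<otimes>\<^bsub>A\<^esub> b) = augmentation a \<otimes>\<^bsub>K\<^esub> augmentation b"
proof -
  have "augmentation (a \<otimes>\<^bsub>A\<^esub> b) = pairing (\<lambda>_. augmentation b) a"
    using assms by (simp add: augmentation_def pairing_mult sum_eq_pairing)
  \<comment> \<open>The constant is written as a multiple of the function one so that
    \<open>pairing_const\<close> applies.\<close>
  also have "\<dots> = pairing (\<lambda>x. augmentation b \<otimes>\<^bsub>K\<^esub> \<one>\<^bsub>K\<^esub>) a"
    using assms by simp
  also have "\<dots> = augmentation b \<otimes>\<^bsub>K\<^esub> augmentation a"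
    using assms by (subst pairing_const) (auto simp: augmentation_def)
  finally show ?thesis using assms by (simp add: K.m_comm)
qed

lemma augmentation_single: "g \<in> carrier E \<Longrightarrow> augmentation (single g) = \<one>\<^bsub>K\<^esub>"
  by (simp add: augmentation_def pairing_single)

lemma augmentation_one: "augmentation \<one>\<^bsub>A\<^esub> = \<one>\<^bsub>K\<^esub>"
  by (simp add: one_A augmentation_single)

definition augmentation_ideal :: "('e \<Rightarrow> 'k) set" where
  "augmentation_ideal = {a \<in> carrier A. augmentation a = \<zero>\<^bsub>K\<^esub>}"

lemma ring_hom_augmentation: "ring_hom_ring A K augmentation"
  by (rule ring_hom_ringI)
    (simp_all add: A.ring_axioms K.ring_axioms augmentation_add augmentation_mult augmentation_one)

text \<open>An ideal strictly above the kernel of the augmentation contains, after rescaling, an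
  element \<open>b\<close> of augmentation one. Then \<open>1 - b\<close> is in the kernel, so the
  ideal contains \<open>1\<close>.\<close>

lemma maximalideal_augmentation: "maximalideal augmentation_ideal A"
proof (rule maximalidealI)
  have "augmentation_ideal = a_kernel A K augmentation"
    by (simp add: augmentation_ideal_def a_kernel_def')
  then show "ideal augmentation_ideal A"
    using ring_hom_ring.kernel_is_ideal[OF ring_hom_augmentation] by simp
  show "carrier A \<noteq> augmentation_ideal"
  proof
    assume "carrier A = augmentation_ideal"
    then have "augmentation \<one>\<^bsub>A\<^esub> = \<zero>\<^bsub>K\<^esub>"
      using A.one_closed by (simp only: augmentation_ideal_def) blast
    then show False by (simp only: augmentation_one K.one_not_zero)
  qed
  fix N assume N: "ideal N A" "augmentation_ideal \<subseteq> N" "N \<subseteq> carrier A"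
  interpret N: ideal N A by fact
  show "N = augmentation_ideal \<or> N = carrier A"
  proof (rule disjCI)
    assume "N \<noteq> carrier A"
    show "N = augmentation_ideal"
    proof (rule ccontr)
      assume "N \<noteq> augmentation_ideal"
      then obtain a where a: "a \<in> N" "augmentation a \<noteq> \<zero>\<^bsub>K\<^esub>"
        using N by (auto simp: augmentation_ideal_def)
      have aA: "a \<in> carrier A" using a N by auto
      then have inv: "inv\<^bsub>K\<^esub> (augmentation a) \<in> carrier K" "inv\<^bsub>K\<^esub> (augmentation a) \<otimes>\<^bsub>K\<^esub> augmentation a = \<one>\<^bsub>K\<^esub>"
        using a(2) K.field_Units by auto
      let ?b = "inv\<^bsub>K\<^esub> (augmentation a) \<odot>\<^bsub>A\<^esub> a"
      have b: "?b \<in> N" "?b \<in> carrier A"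
        using ideal_smult_closed[OF N(1) inv(1) a(1)] N(3) by auto
      have "augmentation (\<one>\<^bsub>A\<^esub> \<ominus>\<^bsub>A\<^esub> ?b) = \<zero>\<^bsub>K\<^esub>"
        using b inv aA by (simp add: augmentation_diff augmentation_one augmentation_smult K.minus_eq K.r_neg)
      then have "\<one>\<^bsub>A\<^esub> \<ominus>\<^bsub>A\<^esub> ?b \<in> N"
        using N(2) b by (auto simp: augmentation_ideal_def)
      then have "(\<one>\<^bsub>A\<^esub> \<ominus>\<^bsub>A\<^esub> ?b) \<oplus>\<^bsub>A\<^esub> ?b \<in> N"
        using b by auto
      then have "\<one>\<^bsub>A\<^esub> \<in> N"
        using b by (simp add: A.minus_eq A.a_assoc A.l_neg)
      with \<open>N \<noteq> carrier A\<close> N.one_imp_carrier show False by simp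
    qed
  qed
qed

lemma single_pow: "g \<in> carrier E \<Longrightarrow> single g [^]\<^bsub>A\<^esub> (m::nat) = single (g [^]\<^bsub>E\<^esub> m)"
  by (induction m) (simp_all add: one_A single_mult_single)

lemma add_pow_A_apply:
  "a \<in> carrier A \<Longrightarrow> x \<in> carrier E \<Longrightarrow> add_pow A (m::nat) a x = add_pow K m (a x)"
  by (induction m) (simp_all add: A_simps(4,5))

text \<open>One inclusion is the maximality of the augmentation ideal. For the other,
  \<open>g - 1\<close> is nilpotent and hence lies in every maximal ideal \<open>N\<close>. Modulo
  \<open>N\<close> all group elements are therefore \<open>1\<close>, and \<open>a\<close> becomes
  \<open>augmentation a \<cdot> 1\<close>.\<close>

lemma jacobson_radical_eq_augmentation_ideal:
  fixes p :: nat
  assumes p: "Factorial_Ring.prime p" and char: "add_pow K p \<one>\<^bsub>K\<^esub> = \<zero>\<^bsub>K\<^esub>"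
    and exp: "\<And>g. g \<in> carrier E \<Longrightarrow> g [^]\<^bsub>E\<^esub> p = \<one>\<^bsub>E\<^esub>"
  shows "jacobson_radical A = augmentation_ideal"
proof
  show "jacobson_radical A \<subseteq> augmentation_ideal"
    using maximalideal_augmentation by (auto simp: jacobson_radical_def)
  have "augmentation_ideal \<subseteq> N" if N: "maximalideal N A" for N
  proof
    interpret N: maximalideal N A by fact
    fix a assume a: "a \<in> augmentation_ideal"
    have charA: "add_pow A p \<one>\<^bsub>A\<^esub> = \<zero>\<^bsub>A\<^esub>"
    proof (rule A_eqI)
      fix x assume "x \<in> carrier E"
      then show "add_pow A p \<one>\<^bsub>A\<^esub> x = \<zero>\<^bsub>A\<^esub> x"
        by (simp add: add_pow_A_apply) (simp add: A_simps(3,4) char)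
    qed simp_all
    have "a \<ominus>\<^bsub>A\<^esub> augmentation a \<odot>\<^bsub>A\<^esub> \<one>\<^bsub>A\<^esub> \<in> N"
    proof (rule ideal_congruence_from_singles[OF N.is_ideal, where L = "\<lambda>a. augmentation a \<odot>\<^bsub>A\<^esub> \<one>\<^bsub>A\<^esub>"])
      fix g assume g: "g \<in> carrier E"
      let ?u = "single g \<ominus>\<^bsub>A\<^esub> \<one>\<^bsub>A\<^esub>"
      have u: "?u \<in> carrier A" by simp
      have u1: "?u \<oplus>\<^bsub>A\<^esub> \<one>\<^bsub>A\<^esub> = single g"
        by (simp add: A.minus_eq A.a_assoc A.l_neg)
      \<comment> \<open>The Frobenius identity is used in the form
        \<open>u^p + 1 = (u + 1)^p = g^p\<close>, which avoids the sign of
        \<open>(-1)^p\<close>.\<close>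
      have "?u [^]\<^bsub>A\<^esub> p \<oplus>\<^bsub>A\<^esub> \<one>\<^bsub>A\<^esub> = single (g [^]\<^bsub>E\<^esub> p)"
        using A.power_prime_add_one[OF u p charA] g by (simp add: u1 single_pow)
      also have "\<dots> = \<one>\<^bsub>A\<^esub>"
        using exp[OF g] by (simp add: one_A)
      finally have "?u [^]\<^bsub>A\<^esub> p = \<zero>\<^bsub>A\<^esub>"
        using A.add.right_cancel[of "\<one>\<^bsub>A\<^esub>" "?u [^]\<^bsub>A\<^esub> p" "\<zero>\<^bsub>A\<^esub>"] u by simp
      then have "?u \<in> N"
        using primeideal.nilpotent_mem[OF A.maximalideal_prime[OF N] u] by simp
      then show "single g \<ominus>\<^bsub>A\<^esub> augmentation (single g) \<odot>\<^bsub>A\<^esub> \<one>\<^bsub>A\<^esub> \<in> N"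
        using g by (simp add: augmentation_single)
    next
      show "(\<lambda>a. augmentation a \<odot>\<^bsub>A\<^esub> \<one>\<^bsub>A\<^esub>) \<in> carrier A \<rightarrow> carrier A"
        by (simp add: smult_closed)
    next
      show "a \<in> carrier A" using a by (simp add: augmentation_ideal_def)
    qed (simp_all add: augmentation_add augmentation_smult AV.smult_l_distr AV.smult_assoc1)
    then show "a \<in> N"
      using a by (simp add: augmentation_ideal_def A.minus_eq)
  qed
  then show "augmentation_ideal \<subseteq> jacobson_radical A"
    by (auto simp: jacobson_radical_def augmentation_ideal_def)
qed

section \<open>Additive functions as derivations\<close>

text \<open>Additivity of \<open>h\<close> turns the inner form of \<open>pairing_mult\<close> into
  \<open>h y \<cdot> augmentation b + pairing h b\<close>. Pairing this with \<open>a\<close> gives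
  the Leibniz rule of a derivation into \<open>k\<close>, on which \<open>kE\<close> acts through
  the augmentation.\<close>

lemma pairing_derivation:
  assumes h: "h \<in> carrier E \<rightarrow> carrier K"
    and hom: "\<And>x y. \<lbrakk>x \<in> carrier E; y \<in> carrier E\<rbrakk> \<Longrightarrow> h (x \<otimes>\<^bsub>E\<^esub> y) = h x \<oplus>\<^bsub>K\<^esub> h y"
    and a: "a \<in> carrier A" and b: "b \<in> carrier A"
  shows "pairing h (a \<otimes>\<^bsub>A\<^esub> b) =
    pairing h a \<otimes>\<^bsub>K\<^esub> augmentation b \<oplus>\<^bsub>K\<^esub> augmentation a \<otimes>\<^bsub>K\<^esub> pairing h b"
proof -
  have hx: "h x \<in> carrier K" if "x \<in> carrier E" for x
    using h that by auto
  \<comment> \<open>The factor \<open>\<one>\<close> is kept so that the second summand is visibly a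
    multiple of the constant function one, whose pairing is the augmentation.\<close>
  let ?g = "\<lambda>y. augmentation b \<otimes>\<^bsub>K\<^esub> h y \<oplus>\<^bsub>K\<^esub> pairing h b \<otimes>\<^bsub>K\<^esub> \<one>\<^bsub>K\<^esub>"
  have inner: "pairing (\<lambda>z. h (y \<otimes>\<^bsub>E\<^esub> z)) b = ?g y" if y: "y \<in> carrier E" for y
  proof -
    have "pairing (\<lambda>z. h (y \<otimes>\<^bsub>E\<^esub> z)) b = pairing (\<lambda>z. h y \<otimes>\<^bsub>K\<^esub> \<one>\<^bsub>K\<^esub> \<oplus>\<^bsub>K\<^esub> h z) b"
      by (rule pairing_cong) (simp_all add: hom hx y b Pi_iff)
    also have "\<dots> = pairing (\<lambda>z. h y \<otimes>\<^bsub>K\<^esub> \<one>\<^bsub>K\<^esub>) b \<oplus>\<^bsub>K\<^esub> pairing h b"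
      by (rule pairing_add_left) (simp_all add: h hx y b)
    also have "pairing (\<lambda>z. h y \<otimes>\<^bsub>K\<^esub> \<one>\<^bsub>K\<^esub>) b = h y \<otimes>\<^bsub>K\<^esub> augmentation b"
      unfolding augmentation_def by (rule pairing_const) (simp_all add: hx y b)
    finally show ?thesis
      using hx[OF y] b h by (simp add: K.m_comm)
  qed
  have "pairing h (a \<otimes>\<^bsub>A\<^esub> b) = (\<Oplus>\<^bsub>K\<^esub>y\<in>carrier E. a y \<otimes>\<^bsub>K\<^esub> ?g y)"
    unfolding pairing_mult[OF h a b]
    by (rule K.finsum_cong') (simp_all add: inner A_mem[OF a] hx h b Pi_iff)
  also have "\<dots> = pairing ?g a"
    by (rule sum_eq_pairing) (simp_all add: hx h a b Pi_iff)
  also have "\<dots> = pairing (\<lambda>y. augmentation b \<otimes>\<^bsub>K\<^esub> h y) a \<oplus>\<^bsub>K\<^esub> pairing (\<lambda>y. pairing h b \<otimes>\<^bsub>K\<^esub> \<one>\<^bsub>K\<^esub>) a"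
    by (rule pairing_add_left) (simp_all add: hx h a b Pi_iff)
  also have "pairing (\<lambda>y. augmentation b \<otimes>\<^bsub>K\<^esub> h y) a = augmentation b \<otimes>\<^bsub>K\<^esub> pairing h a"
    by (rule pairing_const) (simp_all add: h a b)
  also have "pairing (\<lambda>y. pairing h b \<otimes>\<^bsub>K\<^esub> \<one>\<^bsub>K\<^esub>) a = pairing h b \<otimes>\<^bsub>K\<^esub> augmentation a"
    unfolding augmentation_def by (rule pairing_const) (simp_all add: h a b)
  finally show ?thesis
    using a b h by (simp add: K.m_comm)
qed

text \<open>Each term of the Leibniz rule has an augmentation as a factor, which vanishes on the
  augmentation ideal.\<close>

lemma pairing_ideal_prod:
  assumes h: "h \<in> carrier E \<rightarrow> carrier K"
    and hom: "\<And>x y. \<lbrakk>x \<in> carrier E; y \<in> carrier E\<rbrakk> \<Longrightarrow> h (x \<otimes>\<^bsub>E\<^esub> y) = h x \<oplus>\<^bsub>K\<^esub> h y"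
    and a: "a \<in> ideal_prod A augmentation_ideal augmentation_ideal"
  shows "pairing h a = \<zero>\<^bsub>K\<^esub>"
proof -
  have "a \<in> carrier A \<and> pairing h a = \<zero>\<^bsub>K\<^esub>"
    using a
  proof (induction rule: ideal_prod.induct)
    case (prod i j)
    then show ?case
      using h by (simp add: augmentation_ideal_def pairing_derivation[OF h hom])
  next
    case (sum s t)
    then show ?case
      using h by (simp add: pairing_add)
  qed
  then show ?thesis by simp
qed

end

section \<open>Elementary abelian groups\<close>

text \<open>\<open>elementary_abelian\<close> provides a group and an isomorphism; commutativity and
  finiteness, which \<open>group_ring\<close> asks for, are transported back along it.\<close>

lemma elementary_abelian_finite_comm:
  fixes n p :: nat
  assumes E: "group E" and p: "p > 0"
    and iso: "f \<in> iso E (product_group {..<n} (\<lambda>_. integer_mod_group p))"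
  shows "comm_group E" and "finite (carrier E)"
proof -
  interpret E: group E by (rule E)
  have bij: "bij_betw f (carrier E) ({..<n} \<rightarrow>\<^sub>E {0..<int p})"
    using iso p by (simp add: iso_def carrier_integer_mod_group)
  show "finite (carrier E)"
    unfolding bij_betw_finite[OF bij] by (rule finite_PiE) simp_all
  show "comm_group E"
  proof (rule E.group_comm_groupI)
    fix x y assume x: "x \<in> carrier E" and y: "y \<in> carrier E"
    have "f (x \<otimes>\<^bsub>E\<^esub> y) = f (y \<otimes>\<^bsub>E\<^esub> x)"
      using iso x y by (auto simp: iso_def hom_def add.commute)
    then show "x \<otimes>\<^bsub>E\<^esub> y = y \<otimes>\<^bsub>E\<^esub> x"
      using bij_betw_imp_inj_on[OF bij] x y by (auto dest: inj_onD)
  qed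
qed

locale elementary_abelian_group_ring = group_ring K E
  for K :: "('k, 'r) ring_scheme" and E :: "('e, 'g) monoid_scheme" +
  fixes p n :: nat and coord :: "'e \<Rightarrow> nat \<Rightarrow> int"
  assumes prime_p: "Factorial_Ring.prime p"
    and char_p: "add_pow K p \<one>\<^bsub>K\<^esub> = \<zero>\<^bsub>K\<^esub>"
    and coord_iso: "coord \<in> iso E (product_group {..<n} (\<lambda>_. integer_mod_group p))"
begin

section \<open>Coordinates and generators of the group\<close>

lemma p_ge_2: "p \<ge> 2"
  using prime_p by (rule prime_ge_2_nat)

lemma coord_bij: "bij_betw coord (carrier E) ({..<n} \<rightarrow>\<^sub>E {0..<int p})"
  using coord_iso p_ge_2 by (simp add: iso_def carrier_integer_mod_group)

lemma coord_range: "x \<in> carrier E \<Longrightarrow> i < n \<Longrightarrow> 0 \<le> coord x i \<and> coord x i < int p"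
  using bij_betwE[OF coord_bij] by (fastforce simp: PiE_iff)

lemma coord_mult:
  "\<lbrakk>x \<in> carrier E; y \<in> carrier E; i < n\<rbrakk> \<Longrightarrow> coord (x \<otimes>\<^bsub>E\<^esub> y) i = (coord x i + coord y i) mod int p"
  using coord_iso by (simp add: iso_def hom_def)

text \<open>Since \<open>1 \<cdot> 1 = 1\<close>, the coordinate \<open>c\<close> satisfies
  \<open>c = 2 c mod p\<close>, and \<open>0 \<le> c < p\<close> leaves only zero.\<close>

lemma coord_one: "i < n \<Longrightarrow> coord \<one>\<^bsub>E\<^esub> i = 0"
  using coord_mult[of "\<one>\<^bsub>E\<^esub>" "\<one>\<^bsub>E\<^esub>" i] coord_range[of "\<one>\<^bsub>E\<^esub>" i]
  by (simp add: mod_pos_pos_trivial) (smt (verit) minus_mod_self2 mod_pos_pos_trivial)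

lemma coord_inj:
  assumes "x \<in> carrier E" "y \<in> carrier E" "\<And>i. i < n \<Longrightarrow> coord x i = coord y i"
  shows "x = y"
proof -
  have "coord x \<in> {..<n} \<rightarrow>\<^sub>E {0..<int p}" "coord y \<in> {..<n} \<rightarrow>\<^sub>E {0..<int p}"
    using bij_betwE[OF coord_bij] assms(1,2) by blast+
  then have "coord x = coord y"
    by (rule PiE_ext) (simp add: assms(3))
  then show ?thesis
    using bij_betw_imp_inj_on[OF coord_bij] assms(1,2) by (auto dest: inj_onD)
qed

lemma coord_surj:
  assumes "\<And>i. i < n \<Longrightarrow> 0 \<le> c i \<and> c i < int p"
  obtains x where "x \<in> carrier E" "\<And>i. i < n \<Longrightarrow> coord x i = c i"
proof -
  have "restrict c {..<n} \<in> {..<n} \<rightarrow>\<^sub>E {0..<int p}"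
    using assms by simp
  then obtain x where "x \<in> carrier E" "coord x = restrict c {..<n}"
    using bij_betw_imp_surj_on[OF coord_bij] by (metis imageE)
  then show ?thesis using that by simp
qed

lemma exponent_p:
  assumes g: "g \<in> carrier E"
  shows "g [^]\<^bsub>E\<^esub> p = \<one>\<^bsub>E\<^esub>"
proof (rule coord_inj)
  fix i assume i: "i < n"
  have "coord (g [^]\<^bsub>E\<^esub> m) i = (int m * coord g i) mod int p" for m :: nat
    by (induction m) (simp_all add: coord_one coord_mult g i mod_add_right_eq algebra_simps)
  then show "coord (g [^]\<^bsub>E\<^esub> p) i = coord \<one>\<^bsub>E\<^esub> i"
    by (simp add: coord_one i)
qed (simp_all add: g)

text \<open>The standard basis of \<open>E\<close> over the field with \<open>p\<close> elements.
  For \<open>i \<ge> n\<close> all coordinates vanish and the value is the identity.\<close>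

definition gen :: "nat \<Rightarrow> 'e" where
  "gen i = (SOME x. x \<in> carrier E \<and> (\<forall>j<n. coord x j = (if j = i then 1 else 0)))"

lemma gen: "gen i \<in> carrier E \<and> (\<forall>j<n. coord (gen i) j = (if j = i then 1 else 0))"
proof -
  obtain x where "x \<in> carrier E" "\<And>j. j < n \<Longrightarrow> coord x j = (if j = i then 1 else 0)"
    by (rule coord_surj[of "\<lambda>j. if j = i then 1 else 0"]) (use p_ge_2 in auto)
  then show ?thesis
    unfolding gen_def by (intro someI_ex[of "\<lambda>x. x \<in> carrier E \<and> (\<forall>j<n. coord x j = (if j = i then 1 else 0))"]) blast
qed

lemmas gen_closed [simp] = gen[THEN conjunct1]

text \<open>Coordinates are represented by integers in \<open>{0..<p}\<close>, so induction on their
  sum strips off one generator at a time and inverses never occur.\<close>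

lemma gen_induct:
  assumes one: "P \<one>\<^bsub>E\<^esub>"
    and mult: "\<And>x i. \<lbrakk>x \<in> carrier E; P x; i < n\<rbrakk> \<Longrightarrow> P (x \<otimes>\<^bsub>E\<^esub> gen i)"
    and x: "x \<in> carrier E"
  shows "P x"
  using x
proof (induction "\<Sum>i<n. nat (coord x i)" arbitrary: x rule: less_induct)
  case less
  show ?case
  proof (cases "\<forall>i<n. coord x i = 0")
    case True
    then have "x = \<one>\<^bsub>E\<^esub>"
      using less.prems by (intro coord_inj) (auto simp: coord_one)
    with one show ?thesis by simp
  next
    case False
    then obtain i where i: "i < n" "coord x i > 0"
      using coord_range[OF less.prems] by (metis order_le_less)
    \<comment> \<open>Lowering a positive coordinate by one stays within \<open>{0..<p}\<close>, so
      no reduction modulo \<open>p\<close> interferes.\<close>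
    obtain y where y: "y \<in> carrier E" "\<And>j. j < n \<Longrightarrow> coord y j = coord x j - (if j = i then 1 else 0)"
      by (rule coord_surj[of "\<lambda>j. coord x j - (if j = i then 1 else 0)"])
        (use coord_range[OF less.prems] i in fastforce)+
    have "(\<Sum>j<n. nat (coord y j)) < (\<Sum>j<n. nat (coord x j))"
      by (rule sum_strict_mono_ex1) (use i y(2) in auto)
    then have "P (y \<otimes>\<^bsub>E\<^esub> gen i)"
      using mult y(1) i less.hyps by blast
    moreover have "y \<otimes>\<^bsub>E\<^esub> gen i = x"
      by (rule coord_inj)
        (use y gen[of i] coord_range[OF less.prems] less.prems in \<open>simp_all add: coord_mult\<close>)
    ultimately show ?thesis by simp
  qed
qed

section \<open>Additive characters and their derivations\<close>

text \<open>Coordinate \<open>i\<close> read in the prime field of \<open>K\<close>. For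
  \<open>x\<close> in \<open>E\<close> and \<open>i < n\<close> the passage to \<open>nat\<close>
  loses nothing, as the coordinate is nonnegative.\<close>

definition char_coord :: "nat \<Rightarrow> 'e \<Rightarrow> 'k" where
  "char_coord i x = add_pow K (nat (coord x i)) \<one>\<^bsub>K\<^esub>"

lemma char_coord_closed [simp]: "char_coord i x \<in> carrier K"
  by (simp add: char_coord_def)

text \<open>As \<open>p \<cdot> 1 = 0\<close> in \<open>K\<close>, the reduction modulo
  \<open>p\<close> in the group law becomes invisible there; this makes \<open>char_coord i\<close>
  additive.\<close>

lemma add_pow_mod: "add_pow K (m mod p) \<one>\<^bsub>K\<^esub> = add_pow K m \<one>\<^bsub>K\<^esub>"
proof -
  have "add_pow K m \<one>\<^bsub>K\<^esub> = add_pow K (p * (m div p)) \<one>\<^bsub>K\<^esub> \<oplus>\<^bsub>K\<^esub> add_pow K (m mod p) \<one>\<^bsub>K\<^esub>"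
    using K.add.nat_pow_mult[of "\<one>\<^bsub>K\<^esub>" "p * (m div p)" "m mod p"] by simp
  then show ?thesis
    using K.add_pow_eq_zero[OF char_p, of "p * (m div p)" "\<one>\<^bsub>K\<^esub>"] by simp
qed

lemma char_coord_mult:
  assumes "x \<in> carrier E" "y \<in> carrier E" "i < n"
  shows "char_coord i (x \<otimes>\<^bsub>E\<^esub> y) = char_coord i x \<oplus>\<^bsub>K\<^esub> char_coord i y"
proof -
  have "nat (coord (x \<otimes>\<^bsub>E\<^esub> y) i) = (nat (coord x i) + nat (coord y i)) mod p"
    using assms coord_range[of x i] coord_range[of y i]
    by (simp add: coord_mult nat_mod_distrib nat_add_distrib)
  then show ?thesis
    by (simp add: char_coord_def add_pow_mod K.add.nat_pow_mult)
qed

lemma char_coord_gen: "i < n \<Longrightarrow> char_coord i (gen j) = (if i = j then \<one>\<^bsub>K\<^esub> else \<zero>\<^bsub>K\<^esub>)"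
  using gen[of j] by (simp add: char_coord_def)

lemma char_coord_one: "i < n \<Longrightarrow> char_coord i \<one>\<^bsub>E\<^esub> = \<zero>\<^bsub>K\<^esub>"
  by (simp add: char_coord_def coord_one)

text \<open>The form \<open>\<phi>\<^sub>i\<close> of the overview, defined on all of
  \<open>kE\<close>.\<close>

definition deriv_at :: "nat \<Rightarrow> ('e \<Rightarrow> 'k) \<Rightarrow> 'k" where
  "deriv_at i = pairing (char_coord i)"

lemma deriv_closed [simp]: "a \<in> carrier A \<Longrightarrow> deriv_at i a \<in> carrier K"
  by (simp add: deriv_at_def)

lemma deriv_add:
  "\<lbrakk>a \<in> carrier A; b \<in> carrier A\<rbrakk> \<Longrightarrow> deriv_at i (a \<oplus>\<^bsub>A\<^esub> b) = deriv_at i a \<oplus>\<^bsub>K\<^esub> deriv_at i b"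
  by (simp add: deriv_at_def pairing_add)

lemma deriv_diff:
  "\<lbrakk>a \<in> carrier A; b \<in> carrier A\<rbrakk> \<Longrightarrow> deriv_at i (a \<ominus>\<^bsub>A\<^esub> b) = deriv_at i a \<ominus>\<^bsub>K\<^esub> deriv_at i b"
  by (simp add: deriv_at_def pairing_diff)

lemma deriv_smult:
  "\<lbrakk>c \<in> carrier K; a \<in> carrier A\<rbrakk> \<Longrightarrow> deriv_at i (c \<odot>\<^bsub>A\<^esub> a) = c \<otimes>\<^bsub>K\<^esub> deriv_at i a"
  by (simp add: deriv_at_def pairing_smult)

lemma deriv_mult:
  "\<lbrakk>i < n; a \<in> carrier A; b \<in> carrier A\<rbrakk> \<Longrightarrow> deriv_at i (a \<otimes>\<^bsub>A\<^esub> b) =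
    deriv_at i a \<otimes>\<^bsub>K\<^esub> augmentation b \<oplus>\<^bsub>K\<^esub> augmentation a \<otimes>\<^bsub>K\<^esub> deriv_at i b"
  unfolding deriv_at_def by (rule pairing_derivation) (simp_all add: char_coord_mult)

lemma deriv_single: "g \<in> carrier E \<Longrightarrow> deriv_at i (single g) = char_coord i g"
  by (simp add: deriv_at_def pairing_single)

lemma deriv_one: "i < n \<Longrightarrow> deriv_at i \<one>\<^bsub>A\<^esub> = \<zero>\<^bsub>K\<^esub>"
  by (simp add: one_A deriv_single char_coord_one)

abbreviation aug_square :: "('e \<Rightarrow> 'k) set" where
  "aug_square \<equiv> ideal_prod A augmentation_ideal augmentation_ideal"

lemma ideal_augmentation: "ideal augmentation_ideal A"
  using maximalideal_augmentation by (rule maximalideal.axioms)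

lemma ideal_aug_square: "ideal aug_square A"
  by (intro A.ideal_prod_is_ideal ideal_augmentation)

lemma deriv_aug_square: "i < n \<Longrightarrow> a \<in> aug_square \<Longrightarrow> deriv_at i a = \<zero>\<^bsub>K\<^esub>"
  unfolding deriv_at_def by (rule pairing_ideal_prod) (simp_all add: char_coord_mult)

section \<open>First-order expansion modulo the square of the augmentation ideal\<close>

definition shift :: "'e \<Rightarrow> 'e \<Rightarrow> 'k" where
  "shift g = single g \<ominus>\<^bsub>A\<^esub> \<one>\<^bsub>A\<^esub>"

lemma shift_closed [simp]: "shift g \<in> carrier A"
  by (simp add: shift_def)

lemma shift_mem: "g \<in> carrier E \<Longrightarrow> shift g \<in> augmentation_ideal"
  by (simp add: augmentation_ideal_def shift_def augmentation_diff augmentation_single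
      augmentation_one K.minus_eq K.r_neg)

lemma deriv_shift_gen: "i < n \<Longrightarrow> deriv_at i (shift (gen j)) = (if i = j then \<one>\<^bsub>K\<^esub> else \<zero>\<^bsub>K\<^esub>)"
  by (simp add: shift_def deriv_diff deriv_single deriv_one char_coord_gen K.minus_eq)

text \<open>Expand \<open>g h\<close> with \<open>g = (g - 1) + 1\<close> and
  \<open>h = (h - 1) + 1\<close>. The product term lies in the square of the augmentation ideal, so
  modulo that square \<open>shift\<close> is additive.\<close>

lemma shift_mult:
  assumes "g \<in> carrier E" "h \<in> carrier E"
  shows "shift (g \<otimes>\<^bsub>E\<^esub> h) = shift g \<otimes>\<^bsub>A\<^esub> shift h \<oplus>\<^bsub>A\<^esub> (shift g \<oplus>\<^bsub>A\<^esub> shift h)"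
proof -
  have s: "single g = shift g \<oplus>\<^bsub>A\<^esub> \<one>\<^bsub>A\<^esub>" for g
    by (simp add: shift_def A.minus_eq A.a_assoc A.l_neg)
  have "single (g \<otimes>\<^bsub>E\<^esub> h) = single g \<otimes>\<^bsub>A\<^esub> single h"
    using assms by (simp add: single_mult_single)
  also have "\<dots> = (shift g \<oplus>\<^bsub>A\<^esub> \<one>\<^bsub>A\<^esub>) \<otimes>\<^bsub>A\<^esub> (shift h \<oplus>\<^bsub>A\<^esub> \<one>\<^bsub>A\<^esub>)"
    by (simp only: s)
  also have "\<dots> = (shift g \<otimes>\<^bsub>A\<^esub> shift h \<oplus>\<^bsub>A\<^esub> (shift g \<oplus>\<^bsub>A\<^esub> shift h)) \<oplus>\<^bsub>A\<^esub> \<one>\<^bsub>A\<^esub>"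
    by (simp add: A.l_distr A.r_distr A.a_ac)
  finally show ?thesis
    unfolding s[of "g \<otimes>\<^bsub>E\<^esub> h"] by simp
qed

text \<open>The degree-one term of an expansion at the augmentation, with coefficients
  \<open>c\<close>.\<close>

definition linear_part :: "(nat \<Rightarrow> 'k) \<Rightarrow> 'e \<Rightarrow> 'k" where
  "linear_part c = (\<Oplus>\<^bsub>A\<^esub>i\<in>{..<n}. c i \<odot>\<^bsub>A\<^esub> shift (gen i))"

lemma linear_part_closed [simp]:
  "(\<And>i. i < n \<Longrightarrow> c i \<in> carrier K) \<Longrightarrow> linear_part c \<in> carrier A"
  unfolding linear_part_def by (intro A.finsum_closed) (simp add: smult_closed)

lemma linear_part_cong:
  assumes "\<And>i. i < n \<Longrightarrow> d i \<in> carrier K" "\<And>i. i < n \<Longrightarrow> c i = d i"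
  shows "linear_part c = linear_part d"
  unfolding linear_part_def by (rule A.finsum_cong') (simp_all add: smult_closed assms)

lemma linear_part_add:
  assumes "\<And>i. i < n \<Longrightarrow> c i \<in> carrier K" "\<And>i. i < n \<Longrightarrow> d i \<in> carrier K"
  shows "linear_part (\<lambda>i. c i \<oplus>\<^bsub>K\<^esub> d i) = linear_part c \<oplus>\<^bsub>A\<^esub> linear_part d"
proof -
  have "linear_part (\<lambda>i. c i \<oplus>\<^bsub>K\<^esub> d i) =
      (\<Oplus>\<^bsub>A\<^esub>i\<in>{..<n}. c i \<odot>\<^bsub>A\<^esub> shift (gen i) \<oplus>\<^bsub>A\<^esub> d i \<odot>\<^bsub>A\<^esub> shift (gen i))"
    unfolding linear_part_def
    by (rule A.finsum_cong') (simp_all add: smult_closed assms AV.smult_l_distr)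
  also have "\<dots> = linear_part c \<oplus>\<^bsub>A\<^esub> linear_part d"
    unfolding linear_part_def by (rule A.finsum_addf) (simp_all add: smult_closed assms)
  finally show ?thesis .
qed

lemma linear_part_smult:
  assumes "\<And>i. i < n \<Longrightarrow> d i \<in> carrier K" "c \<in> carrier K"
  shows "linear_part (\<lambda>i. c \<otimes>\<^bsub>K\<^esub> d i) = c \<odot>\<^bsub>A\<^esub> linear_part d"
proof -
  have "c \<odot>\<^bsub>A\<^esub> linear_part d = (\<Oplus>\<^bsub>A\<^esub>i\<in>{..<n}. c \<odot>\<^bsub>A\<^esub> (d i \<odot>\<^bsub>A\<^esub> shift (gen i)))"
    unfolding linear_part_def
    by (rule AV.finsum_smult) (simp_all add: smult_closed assms)
  also have "\<dots> = linear_part (\<lambda>i. c \<otimes>\<^bsub>K\<^esub> d i)"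
    unfolding linear_part_def
    by (rule A.finsum_cong') (simp_all add: smult_closed assms AV.smult_assoc1)
  finally show ?thesis by simp
qed

lemma linear_part_zero: "linear_part (\<lambda>_. \<zero>\<^bsub>K\<^esub>) = \<zero>\<^bsub>A\<^esub>"
  unfolding linear_part_def by (rule A.add.finprod_one_eqI) simp

lemma linear_part_unit:
  assumes "j < n"
  shows "linear_part (\<lambda>i. if i = j then \<one>\<^bsub>K\<^esub> else \<zero>\<^bsub>K\<^esub>) = shift (gen j)"
proof -
  have "linear_part (\<lambda>i. if i = j then \<one>\<^bsub>K\<^esub> else \<zero>\<^bsub>K\<^esub>) =
      (\<Oplus>\<^bsub>A\<^esub>i\<in>{..<n}. if j = i then shift (gen i) else \<zero>\<^bsub>A\<^esub>)"
    unfolding linear_part_def by (rule A.finsum_cong') simp_all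
  also have "\<dots> = shift (gen j)"
    by (rule A.finsum_singleton) (simp_all add: assms)
  finally show ?thesis .
qed

text \<open>Modulo the square both terms are additive in \<open>g\<close>: \<open>shift\<close> by
  \<open>shift_mult\<close>, the linear part because each \<open>char_coord i\<close> is a
  homomorphism. Since they agree on generators, \<open>gen_induct\<close> carries the congruence to
  all of \<open>E\<close>.\<close>

lemma shift_congruence:
  assumes "g \<in> carrier E"
  shows "shift g \<ominus>\<^bsub>A\<^esub> linear_part (\<lambda>i. char_coord i g) \<in> aug_square"
proof -
  interpret N: ideal aug_square A by (rule ideal_aug_square)
  show ?thesis
  proof (rule gen_induct[OF _ _ assms])
    have "linear_part (\<lambda>i. char_coord i \<one>\<^bsub>E\<^esub>) = \<zero>\<^bsub>A\<^esub>"
      unfolding linear_part_zero[symmetric] by (rule linear_part_cong) (simp_all add: char_coord_one)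
    then show "shift \<one>\<^bsub>E\<^esub> \<ominus>\<^bsub>A\<^esub> linear_part (\<lambda>i. char_coord i \<one>\<^bsub>E\<^esub>) \<in> aug_square"
      by (simp add: shift_def one_A[symmetric] A.minus_eq A.r_neg)
  next
    fix x i
    let ?S = "\<lambda>x. linear_part (\<lambda>i. char_coord i x)"
    assume x: "x \<in> carrier E" "shift x \<ominus>\<^bsub>A\<^esub> ?S x \<in> aug_square" and i: "i < n"
    have "?S (x \<otimes>\<^bsub>E\<^esub> gen i) = linear_part (\<lambda>j. char_coord j x \<oplus>\<^bsub>K\<^esub> (if j = i then \<one>\<^bsub>K\<^esub> else \<zero>\<^bsub>K\<^esub>))"
      by (rule linear_part_cong) (simp_all add: char_coord_mult char_coord_gen x)
    also have "\<dots> = ?S x \<oplus>\<^bsub>A\<^esub> shift (gen i)"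
      by (subst linear_part_add) (simp_all add: linear_part_unit i)
    finally have "shift (x \<otimes>\<^bsub>E\<^esub> gen i) \<ominus>\<^bsub>A\<^esub> ?S (x \<otimes>\<^bsub>E\<^esub> gen i) =
        shift x \<otimes>\<^bsub>A\<^esub> shift (gen i) \<oplus>\<^bsub>A\<^esub> (shift x \<oplus>\<^bsub>A\<^esub> shift (gen i)) \<ominus>\<^bsub>A\<^esub> (?S x \<oplus>\<^bsub>A\<^esub> shift (gen i))"
      by (simp add: shift_mult x)
    \<comment> \<open>The two copies of \<open>shift (gen i)\<close> cancel. A product of two
      elements of the augmentation ideal and the difference from the induction hypothesis
      remain.\<close>
    also have "\<dots> = shift x \<otimes>\<^bsub>A\<^esub> shift (gen i) \<oplus>\<^bsub>A\<^esub> (shift x \<ominus>\<^bsub>A\<^esub> ?S x)"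
      by (simp add: A.minus_eq A.minus_add A.a_ac A.r_neg A.r_neg1 A.r_neg2)
    also have "\<dots> \<in> aug_square"
      using x by (intro N.a_closed ideal_prod.prod shift_mem) simp_all
    finally show "shift (x \<otimes>\<^bsub>E\<^esub> gen i) \<ominus>\<^bsub>A\<^esub> ?S (x \<otimes>\<^bsub>E\<^esub> gen i) \<in> aug_square" .
  qed
qed

text \<open>Linear extension of \<open>shift_congruence\<close> gives the Taylor expansion
  \<open>?L a\<close> of \<open>a\<close> modulo the square. If all its coefficients vanish,
  \<open>a\<close> itself lies in the square.\<close>

lemma aug_square_if_derivs_zero:
  assumes a: "a \<in> augmentation_ideal" and d: "\<And>i. i < n \<Longrightarrow> deriv_at i a = \<zero>\<^bsub>K\<^esub>"
  shows "a \<in> aug_square"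
proof -
  let ?L = "\<lambda>a. augmentation a \<odot>\<^bsub>A\<^esub> \<one>\<^bsub>A\<^esub> \<oplus>\<^bsub>A\<^esub> linear_part (\<lambda>i. deriv_at i a)"
  have aA: "a \<in> carrier A" and ea: "augmentation a = \<zero>\<^bsub>K\<^esub>"
    using a by (simp_all add: augmentation_ideal_def)
  have "a \<ominus>\<^bsub>A\<^esub> ?L a \<in> aug_square"
  proof (rule ideal_congruence_from_singles[OF ideal_aug_square, where L = ?L])
    fix a b assume "a \<in> carrier A" "b \<in> carrier A"
    then show "?L (a \<oplus>\<^bsub>A\<^esub> b) = ?L a \<oplus>\<^bsub>A\<^esub> ?L b"
      by (simp add: augmentation_add deriv_add linear_part_add AV.smult_l_distr smult_closed A.a_ac)
  next
    fix c a assume "c \<in> carrier K" "a \<in> carrier A"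
    then show "?L (c \<odot>\<^bsub>A\<^esub> a) = c \<odot>\<^bsub>A\<^esub> ?L a"
      by (simp add: augmentation_smult deriv_smult linear_part_smult AV.smult_assoc1 AV.smult_r_distr smult_closed)
  next
    fix g assume g: "g \<in> carrier E"
    \<comment> \<open>\<open>single g\<close> has augmentation one, so removing the constant term
      leaves \<open>shift g\<close>.\<close>
    have "single g \<ominus>\<^bsub>A\<^esub> ?L (single g) = shift g \<ominus>\<^bsub>A\<^esub> linear_part (\<lambda>i. char_coord i g)"
      using g by (simp add: augmentation_single deriv_single shift_def A.minus_eq A.minus_add A.a_assoc)
    then show "single g \<ominus>\<^bsub>A\<^esub> ?L (single g) \<in> aug_square"
      using shift_congruence[OF g] by simp
  qed (simp_all add: aA smult_closed)
  moreover have "linear_part (\<lambda>i. deriv_at i a) = \<zero>\<^bsub>A\<^esub>"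
    unfolding linear_part_zero[symmetric] by (rule linear_part_cong) (simp_all add: d)
  ultimately show ?thesis
    using aA ea by (simp add: A.minus_eq)
qed

lemma jacobson_radical_A: "jacobson_radical A = augmentation_ideal"
  by (rule jacobson_radical_eq_augmentation_ideal[OF prime_p char_p exponent_p])

lemma deriv_zero: "deriv_at i \<zero>\<^bsub>A\<^esub> = \<zero>\<^bsub>K\<^esub>"
  using deriv_smult[of "\<zero>\<^bsub>K\<^esub>" "\<zero>\<^bsub>A\<^esub>" i] by simp

lemma deriv_finsum:
  assumes "finite S" "\<And>s. s \<in> S \<Longrightarrow> f s \<in> carrier A"
  shows "deriv_at i (\<Oplus>\<^bsub>A\<^esub>s\<in>S. f s) = (\<Oplus>\<^bsub>K\<^esub>s\<in>S. deriv_at i (f s))"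
  using assms
proof (induction S)
  case (insert s S)
  have "f s \<in> carrier A" "f \<in> S \<rightarrow> carrier A"
    using insert.prems by auto
  moreover have "(\<lambda>s. deriv_at i (f s)) \<in> S \<rightarrow> carrier K"
    using insert.prems by simp
  ultimately show ?case
    using insert by (simp add: deriv_add A.finsum_closed)
qed (simp add: deriv_zero)

lemma submodule_deriv_kernel: "submodule K {a \<in> carrier A. deriv_at i a = \<zero>\<^bsub>K\<^esub>} A"
proof (rule submodule.intro)
  show "Module.module K A" by (rule AV.module_axioms)
  show "{a \<in> carrier A. deriv_at i a = \<zero>\<^bsub>K\<^esub>} \<subseteq> carrier A" by blast
qed (simp_all add: deriv_add deriv_smult deriv_zero smult_closed)

end

section \<open>The space \<open>V\<close>\<close>

locale rad_complement_space = elementary_abelian_group_ring K E p n coord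
  for K :: "('k, 'r) ring_scheme" and E :: "('e, 'g) monoid_scheme" and p n coord +
  fixes V :: "('e \<Rightarrow> 'k) set"
  assumes rad_complement_V: "rad_complement K E V"
begin

lemma V_subspace: "VectorSpace.subspace K V A"
  and V_aug: "V \<subseteq> augmentation_ideal"
  and V_bij: "bij_betw (\<lambda>v. aug_square +>\<^bsub>A\<^esub> v) V
    (carrier ((A\<lparr>carrier := augmentation_ideal\<rparr>) A_Mod aug_square))"
  using rad_complement_V by (simp_all add: rad_complement_def Let_def jacobson_radical_A)

lemma V_submodule: "submodule K V A"
  using V_subspace by simp

lemma V_carrier: "v \<in> V \<Longrightarrow> v \<in> carrier A"
  using V_aug by (auto simp: augmentation_ideal_def)

section \<open>The derivations as coordinates on the complement\<close>

text \<open>The injective half of \<open>V \<cong> Rad / Rad\<^sup>2\<close>: such a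
  \<open>v\<close> lies in the square, so it has the same coset as zero.\<close>

lemma V_eq_zero_if_derivs_zero:
  assumes v: "v \<in> V" and d: "\<And>i. i < n \<Longrightarrow> deriv_at i v = \<zero>\<^bsub>K\<^esub>"
  shows "v = \<zero>\<^bsub>A\<^esub>"
proof -
  interpret N: ideal aug_square A by (rule ideal_aug_square)
  have "v \<in> aug_square"
    using v V_aug d by (intro aug_square_if_derivs_zero) auto
  then have "aug_square +>\<^bsub>A\<^esub> v = aug_square +>\<^bsub>A\<^esub> \<zero>\<^bsub>A\<^esub>"
    by (metis A.a_coset_join2 A.zero_closed N.a_subgroup N.additive_subgroup_axioms
        V_carrier additive_subgroup.zero_closed v)
  moreover have "\<zero>\<^bsub>A\<^esub> \<in> V"
    using V_submodule by (rule submodule.zero_closed)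
  ultimately show ?thesis
    using v bij_betw_imp_inj_on[OF V_bij] by (auto dest: inj_onD)
qed

text \<open>The surjective half: the class of \<open>gen i - 1\<close> has a representative in
  \<open>V\<close>, and the derivations do not see the correction by an element of the
  square.\<close>

lemma dual_vector_exists:
  assumes "i < n"
  shows "\<exists>v\<in>V. \<forall>j<n. deriv_at j v = (if j = i then \<one>\<^bsub>K\<^esub> else \<zero>\<^bsub>K\<^esub>)"
proof -
  interpret N: ideal aug_square A by (rule ideal_aug_square)
  have "aug_square +>\<^bsub>A\<^esub> shift (gen i) \<in> carrier ((A\<lparr>carrier := augmentation_ideal\<rparr>) A_Mod aug_square)"
    using shift_mem[of "gen i"]
    by (auto simp: A_FactGroup_def FactGroup_def RCOSETS_def a_r_coset_def r_coset_def)
  then have "aug_square +>\<^bsub>A\<^esub> shift (gen i) \<in> (\<lambda>v. aug_square +>\<^bsub>A\<^esub> v) ` V"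
    by (simp only: bij_betw_imp_surj_on[OF V_bij])
  then obtain v where v: "v \<in> V" "aug_square +>\<^bsub>A\<^esub> v = aug_square +>\<^bsub>A\<^esub> shift (gen i)"
    by (rule imageE) simp
  have "v \<in> aug_square +>\<^bsub>A\<^esub> v"
    using V_carrier[OF v(1)] by (rule N.a_rcos_self)
  then obtain s where s: "s \<in> aug_square" "v = s \<oplus>\<^bsub>A\<^esub> shift (gen i)"
    unfolding v(2) by (auto simp: a_r_coset_def r_coset_def)
  have "deriv_at j v = (if j = i then \<one>\<^bsub>K\<^esub> else \<zero>\<^bsub>K\<^esub>)" if "j < n" for j
    using that s N.Icarr[OF s(1)] by (simp add: deriv_add deriv_aug_square deriv_shift_gen)
  with v(1) show ?thesis by blast
qed

definition dual_vector :: "nat \<Rightarrow> 'e \<Rightarrow> 'k" where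
  "dual_vector i = (SOME v. v \<in> V \<and> (\<forall>j<n. deriv_at j v = (if j = i then \<one>\<^bsub>K\<^esub> else \<zero>\<^bsub>K\<^esub>)))"

lemma dual_vector:
  assumes "i < n"
  shows "dual_vector i \<in> V"
    and "\<And>j. j < n \<Longrightarrow> deriv_at j (dual_vector i) = (if j = i then \<one>\<^bsub>K\<^esub> else \<zero>\<^bsub>K\<^esub>)"
proof -
  have "\<exists>v. v \<in> V \<and> (\<forall>j<n. deriv_at j v = (if j = i then \<one>\<^bsub>K\<^esub> else \<zero>\<^bsub>K\<^esub>))"
    using dual_vector_exists[OF assms] by auto
  from someI_ex[OF this, folded dual_vector_def]
  show "dual_vector i \<in> V"
    and "\<And>j. j < n \<Longrightarrow> deriv_at j (dual_vector i) = (if j = i then \<one>\<^bsub>K\<^esub> else \<zero>\<^bsub>K\<^esub>)" by auto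
qed

lemma dual_vector_inj: "inj_on dual_vector {..<n}"
proof (rule inj_onI)
  fix i j assume "i \<in> {..<n}" "j \<in> {..<n}" "dual_vector i = dual_vector j"
  then show "i = j"
    using dual_vector(2)[of i i] dual_vector(2)[of j i] K.one_not_zero by (auto split: if_splits)
qed

section \<open>Coordinate subspaces and their dimension\<close>

definition coord_space :: "nat set \<Rightarrow> ('e \<Rightarrow> 'k) set" where
  "coord_space S = AV.span (dual_vector ` S)"

context
  fixes S assumes S: "S \<subseteq> {..<n}"
begin

lemma dual_vectors_V: "dual_vector ` S \<subseteq> V"
  using S dual_vector(1) by auto

lemma dual_vectors_carrier: "dual_vector ` S \<subseteq> carrier A"
  using dual_vectors_V V_carrier by auto

lemma S_finite: "finite S"
  using S finite_lessThan by (rule finite_subset)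

lemma dual_vectors_finite: "finite (dual_vector ` S)"
  using S_finite by simp

lemma coord_space_subset: "coord_space S \<subseteq> V"
  unfolding coord_space_def by (rule AV.span_is_subset[OF dual_vectors_V V_submodule])

lemma coord_space_subspace: "VectorSpace.subspace K (coord_space S) A"
  unfolding coord_space_def by (rule AV.span_is_subspace[OF dual_vectors_carrier])

text \<open>Applying \<open>deriv_at j\<close> to a linear relation isolates the coefficient of
  \<open>dual_vector j\<close>.\<close>

lemma coord_space_dim: "subspace_dim K A (coord_space S) = card S"
proof -
  have "AV.lin_indpt (dual_vector ` S)"
  proof (rule AV.finite_lin_indpt2[OF dual_vectors_finite dual_vectors_carrier])
    fix a assume a: "a \<in> dual_vector ` S \<rightarrow> carrier K" and z: "AV.lincomb a (dual_vector ` S) = \<zero>\<^bsub>A\<^esub>"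
    show "\<forall>v\<in>dual_vector ` S. a v = \<zero>\<^bsub>K\<^esub>"
    proof
      fix v assume "v \<in> dual_vector ` S"
      then obtain j where j: "j \<in> S" "v = dual_vector j" by auto
      have jn: "j < n" using j S by auto
      have "deriv_at j (AV.lincomb a (dual_vector ` S)) =
          (\<Oplus>\<^bsub>K\<^esub>w\<in>dual_vector ` S. deriv_at j (a w \<odot>\<^bsub>A\<^esub> w))"
        unfolding AV.lincomb_def
        by (rule deriv_finsum[OF dual_vectors_finite])
          (use a dual_vectors_carrier in \<open>auto intro!: smult_closed\<close>)
      also have "\<dots> = (\<Oplus>\<^bsub>K\<^esub>w\<in>dual_vector ` S. if dual_vector j = w then a w else \<zero>\<^bsub>K\<^esub>)"
      proof (rule K.finsum_cong')
        fix w assume w: "w \<in> dual_vector ` S"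
        then obtain i where i: "i \<in> S" "w = dual_vector i" by auto
        \<comment> \<open>The relation is indexed by vectors instead of indices; injectivity of
          \<open>dual_vector\<close> translates between the two.\<close>
        have "dual_vector j = w \<longleftrightarrow> j = i"
          unfolding i(2) by (rule inj_on_eq_iff[OF dual_vector_inj]) (use i j S in auto)
        moreover have "a w \<in> carrier K" "w \<in> carrier A"
          using a w dual_vectors_carrier by auto
        ultimately show "deriv_at j (a w \<odot>\<^bsub>A\<^esub> w) = (if dual_vector j = w then a w else \<zero>\<^bsub>K\<^esub>)"
          using i S jn by (auto simp: deriv_smult dual_vector(2))
      qed (use a in auto)
      also have "\<dots> = a v"
        unfolding j(2) by (rule K.finsum_singleton) (use j dual_vectors_finite a in auto)
      finally show "a v = \<zero>\<^bsub>K\<^esub>"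
        by (simp add: z deriv_zero)
    qed
  qed
  then have "subspace_dim K A (coord_space S) = card (dual_vector ` S)"
    unfolding subspace_dim_def coord_space_def
    by (intro AV.dim_span dual_vectors_finite dual_vectors_carrier)
  also have "\<dots> = card S"
    by (rule card_image[OF inj_on_subset[OF dual_vector_inj S]])
  finally show ?thesis .
qed

lemma deriv_coord_space:
  assumes "i < n" "i \<notin> S" "v \<in> coord_space S"
  shows "deriv_at i v = \<zero>\<^bsub>K\<^esub>"
proof -
  have "dual_vector ` S \<subseteq> {a \<in> carrier A. deriv_at i a = \<zero>\<^bsub>K\<^esub>}"
  proof
    fix w assume "w \<in> dual_vector ` S"
    then obtain j where j: "j \<in> S" "w = dual_vector j" by blast
    with S assms(1,2) have "j < n" "i \<noteq> j" by auto
    with j(2) show "w \<in> {a \<in> carrier A. deriv_at i a = \<zero>\<^bsub>K\<^esub>}"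
      using dual_vector[of j] V_carrier[of w] assms(1) by simp
  qed
  then have "coord_space S \<subseteq> {a \<in> carrier A. deriv_at i a = \<zero>\<^bsub>K\<^esub>}"
    unfolding coord_space_def by (intro AV.span_is_subset submodule_deriv_kernel)
  with assms(3) show ?thesis by auto
qed

text \<open>Each \<open>u \<in> U\<close> has the same derivations as its expansion in the vectors
  \<open>dual_vector i\<close>, \<open>i \<in> S\<close>, hence equals it. So \<open>U\<close> lies
  in the span of at most \<open>card S\<close> vectors.\<close>

lemma dim_le_card_if_derivs_zero:
  assumes U: "VectorSpace.subspace K U A" "U \<subseteq> V"
    and zero: "\<And>u i. \<lbrakk>u \<in> U; i < n; i \<notin> S\<rbrakk> \<Longrightarrow> deriv_at i u = \<zero>\<^bsub>K\<^esub>"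
  shows "subspace_dim K A U \<le> card S"
proof -
  have "U \<subseteq> coord_space S"
  proof
    fix u assume u: "u \<in> U"
    have uA: "u \<in> carrier A" using V_carrier u U(2) by blast
    let ?s = "\<Oplus>\<^bsub>A\<^esub>i\<in>S. deriv_at i u \<odot>\<^bsub>A\<^esub> dual_vector i"
    have summand: "deriv_at i u \<odot>\<^bsub>A\<^esub> dual_vector i \<in> coord_space S" if "i \<in> S" for i
    proof -
      have "dual_vector i \<in> coord_space S"
        unfolding coord_space_def using AV.in_own_span[OF dual_vectors_carrier] that by auto
      moreover have "submodule K (coord_space S) A"
        using coord_space_subspace by simp
      ultimately show ?thesis
        using uA by (simp add: submodule.smult_closed)
    qed
    have s: "?s \<in> coord_space S"
      using coord_space_subspace summand by (intro AV.submodule_finsum) simp_all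
    have sV: "?s \<in> V" using s coord_space_subset by auto
    have "deriv_at j ?s = deriv_at j u" if j: "j < n" for j
    proof -
      have "deriv_at j ?s = (\<Oplus>\<^bsub>K\<^esub>i\<in>S. deriv_at j (deriv_at i u \<odot>\<^bsub>A\<^esub> dual_vector i))"
        by (rule deriv_finsum) (use S_finite summand coord_space_subset V_carrier in auto)
      also have "\<dots> = (\<Oplus>\<^bsub>K\<^esub>i\<in>S. if j = i then deriv_at i u else \<zero>\<^bsub>K\<^esub>)"
        by (rule K.finsum_cong')
          (use S j uA dual_vector V_carrier in \<open>auto simp: deriv_smult subset_iff\<close>)
      \<comment> \<open>For \<open>j \<notin> S\<close> the sum is empty of contributions, and the
        right-hand side vanishes by the assumption on \<open>U\<close>.\<close>
      also have "\<dots> = deriv_at j u"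
      proof (cases "j \<in> S")
        case True
        then show ?thesis
          using S_finite uA by (intro K.finsum_singleton) auto
      next
        case False
        then have "(\<Oplus>\<^bsub>K\<^esub>i\<in>S. if j = i then deriv_at i u else \<zero>\<^bsub>K\<^esub>) = \<zero>\<^bsub>K\<^esub>"
          by (intro K.add.finprod_one_eqI) auto
        with False show ?thesis using zero[OF u j] by simp
      qed
      finally show ?thesis .
    qed
    \<comment> \<open>Vanishing derivations force an element to be zero only inside
      \<open>V\<close>, so the difference must be placed there first.\<close>
    moreover have "u \<ominus>\<^bsub>A\<^esub> ?s \<in> V"
    proof -
      have "\<ominus>\<^bsub>A\<^esub> ?s = (\<ominus>\<^bsub>K\<^esub> \<one>\<^bsub>K\<^esub>) \<odot>\<^bsub>A\<^esub> ?s"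
        using V_carrier[OF sV] by (simp add: AV.smult_minus_1)
      then have "\<ominus>\<^bsub>A\<^esub> ?s \<in> V"
        using sV V_submodule by (simp add: submodule.smult_closed)
      then show ?thesis
        using u U(2) V_submodule by (auto simp: A.minus_eq submodule.m_closed)
    qed
    ultimately have "u \<ominus>\<^bsub>A\<^esub> ?s = \<zero>\<^bsub>A\<^esub>"
      using uA V_carrier[OF sV]
      by (intro V_eq_zero_if_derivs_zero) (simp_all add: deriv_diff K.minus_eq K.r_neg)
    then have "u = ?s"
      using uA V_carrier[OF sV] by simp
    with s show "u \<in> coord_space S" by simp
  qed
  then have "subspace_dim K A U \<le> card (dual_vector ` S)"
    unfolding subspace_dim_def coord_space_def
    by (intro AV.dim_le_card_if_subset_span dual_vectors_finite dual_vectors_carrier U)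
  also have "\<dots> \<le> card S"
    using S_finite by (rule card_image_le)
  finally show ?thesis .
qed

end

end

section \<open>The module of Loewy length two\<close>

context elementary_abelian_group_ring
begin

section \<open>The action and its module laws\<close>

text \<open>The off-diagonal part of the representation: \<open>a\<close> acts by a block triangular
  matrix with \<open>augmentation a\<close> on the diagonal and the row of all
  \<open>deriv_at t a\<close>, \<open>t \<in> T\<close>, leading from the top to the socle.\<close>

definition slope :: "nat set \<Rightarrow> ('e \<Rightarrow> 'k) \<Rightarrow> (nat \<Rightarrow> 'k) \<Rightarrow> 'k" where
  "slope T a m = (\<Oplus>\<^bsub>K\<^esub>t\<in>T. deriv_at t a \<otimes>\<^bsub>K\<^esub> m t)"

text \<open>The coordinates in \<open>T\<close> form the top of the module, the coordinate \<open>n\<close> its socle.\<close>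

definition ext_module :: "nat set \<Rightarrow> ('e \<Rightarrow> 'k, nat \<Rightarrow> 'k) module" where
  "ext_module T =
     \<lparr>carrier = insert n T \<rightarrow>\<^sub>E carrier K, monoid.mult = undefined, one = undefined,
      ring.zero = (\<lambda>i\<in>insert n T. \<zero>\<^bsub>K\<^esub>),
      add = (\<lambda>m m'. \<lambda>i\<in>insert n T. m i \<oplus>\<^bsub>K\<^esub> m' i),
      module.smult = (\<lambda>a m. \<lambda>i\<in>insert n T. augmentation a \<otimes>\<^bsub>K\<^esub> m i \<oplus>\<^bsub>K\<^esub>
        (if i = n then slope T a m else \<zero>\<^bsub>K\<^esub>))\<rparr>"

context
  fixes T assumes T: "T \<subseteq> {..<n}"
begin

abbreviation M :: "('e \<Rightarrow> 'k, nat \<Rightarrow> 'k) module" where "M \<equiv> ext_module T"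

lemma M_simps:
  "carrier M = insert n T \<rightarrow>\<^sub>E carrier K"
  "\<zero>\<^bsub>M\<^esub> = (\<lambda>i\<in>insert n T. \<zero>\<^bsub>K\<^esub>)"
  "m \<oplus>\<^bsub>M\<^esub> m' = (\<lambda>i\<in>insert n T. m i \<oplus>\<^bsub>K\<^esub> m' i)"
  "a \<odot>\<^bsub>M\<^esub> m = (\<lambda>i\<in>insert n T. augmentation a \<otimes>\<^bsub>K\<^esub> m i \<oplus>\<^bsub>K\<^esub> (if i = n then slope T a m else \<zero>\<^bsub>K\<^esub>))"
  by (simp_all add: ext_module_def)

lemma M_apply:
  assumes "i \<in> insert n T"
  shows "(m \<oplus>\<^bsub>M\<^esub> m') i = m i \<oplus>\<^bsub>K\<^esub> m' i"
    and "(a \<odot>\<^bsub>M\<^esub> m) i = augmentation a \<otimes>\<^bsub>K\<^esub> m i \<oplus>\<^bsub>K\<^esub> (if i = n then slope T a m else \<zero>\<^bsub>K\<^esub>)"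
  using assms by (simp_all only: M_simps restrict_apply')

lemma T_finite: "finite T"
  using T finite_lessThan by (rule finite_subset)

lemma T_less: "t \<in> T \<Longrightarrow> t < n" and n_notin_T: "n \<notin> T"
  using T by auto

lemma M_mem: "m \<in> carrier M \<Longrightarrow> i \<in> insert n T \<Longrightarrow> m i \<in> carrier K"
  unfolding M_simps(1) by (rule PiE_mem)

lemma slope_closed: "a \<in> carrier A \<Longrightarrow> m \<in> carrier M \<Longrightarrow> slope T a m \<in> carrier K"
  unfolding slope_def by (rule K.finsum_closed) (simp add: M_mem)

lemma slope_add_left:
  assumes "a \<in> carrier A" "b \<in> carrier A" "m \<in> carrier M"
  shows "slope T (a \<oplus>\<^bsub>A\<^esub> b) m = slope T a m \<oplus>\<^bsub>K\<^esub> slope T b m"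
proof -
  have "slope T (a \<oplus>\<^bsub>A\<^esub> b) m = (\<Oplus>\<^bsub>K\<^esub>t\<in>T. deriv_at t a \<otimes>\<^bsub>K\<^esub> m t \<oplus>\<^bsub>K\<^esub> deriv_at t b \<otimes>\<^bsub>K\<^esub> m t)"
    unfolding slope_def by (rule K.finsum_cong') (simp_all add: assms M_mem deriv_add K.l_distr)
  also have "\<dots> = slope T a m \<oplus>\<^bsub>K\<^esub> slope T b m"
    unfolding slope_def by (rule K.finsum_addf) (simp_all add: assms M_mem)
  finally show ?thesis .
qed

lemma slope_add_right:
  assumes "a \<in> carrier A" "m \<in> carrier M" "m' \<in> carrier M"
  shows "slope T a (m \<oplus>\<^bsub>M\<^esub> m') = slope T a m \<oplus>\<^bsub>K\<^esub> slope T a m'"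
proof -
  have "slope T a (m \<oplus>\<^bsub>M\<^esub> m') = (\<Oplus>\<^bsub>K\<^esub>t\<in>T. deriv_at t a \<otimes>\<^bsub>K\<^esub> m t \<oplus>\<^bsub>K\<^esub> deriv_at t a \<otimes>\<^bsub>K\<^esub> m' t)"
    unfolding slope_def by (rule K.finsum_cong') (simp_all add: assms M_mem M_simps(3) K.r_distr)
  also have "\<dots> = slope T a m \<oplus>\<^bsub>K\<^esub> slope T a m'"
    unfolding slope_def by (rule K.finsum_addf) (simp_all add: assms M_mem)
  finally show ?thesis .
qed

text \<open>The hypothesis constrains \<open>m'\<close> on \<open>T\<close> only. It is thus
  available for \<open>m' = b \<odot> m\<close>, which is a multiple of \<open>m\<close> on the top
  but in general not in the socle coordinate.\<close>

lemma slope_const: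
  assumes "a \<in> carrier A" "m \<in> carrier M" "c \<in> carrier K" "\<And>t. t \<in> T \<Longrightarrow> m' t = c \<otimes>\<^bsub>K\<^esub> m t"
  shows "slope T a m' = c \<otimes>\<^bsub>K\<^esub> slope T a m"
proof -
  have "c \<otimes>\<^bsub>K\<^esub> slope T a m = (\<Oplus>\<^bsub>K\<^esub>t\<in>T. c \<otimes>\<^bsub>K\<^esub> (deriv_at t a \<otimes>\<^bsub>K\<^esub> m t))"
    unfolding slope_def by (rule K.finsum_rdistr) (simp_all add: T_finite assms M_mem)
  also have "\<dots> = slope T a m'"
    unfolding slope_def by (rule K.finsum_cong') (simp_all add: assms M_mem K.m_lcomm)
  finally show ?thesis by simp
qed

lemma slope_mult:
  assumes "a \<in> carrier A" "b \<in> carrier A" "m \<in> carrier M"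
  shows "slope T (a \<otimes>\<^bsub>A\<^esub> b) m =
    augmentation b \<otimes>\<^bsub>K\<^esub> slope T a m \<oplus>\<^bsub>K\<^esub> augmentation a \<otimes>\<^bsub>K\<^esub> slope T b m"
proof -
  have "slope T (a \<otimes>\<^bsub>A\<^esub> b) m = (\<Oplus>\<^bsub>K\<^esub>t\<in>T. augmentation b \<otimes>\<^bsub>K\<^esub> (deriv_at t a \<otimes>\<^bsub>K\<^esub> m t) \<oplus>\<^bsub>K\<^esub>
      augmentation a \<otimes>\<^bsub>K\<^esub> (deriv_at t b \<otimes>\<^bsub>K\<^esub> m t))"
    unfolding slope_def
    by (rule K.finsum_cong')
      (simp_all add: assms M_mem T_less deriv_mult K.l_distr K.r_distr K.m_ac)
  also have "\<dots> = (\<Oplus>\<^bsub>K\<^esub>t\<in>T. augmentation b \<otimes>\<^bsub>K\<^esub> (deriv_at t a \<otimes>\<^bsub>K\<^esub> m t)) \<oplus>\<^bsub>K\<^esub>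
      (\<Oplus>\<^bsub>K\<^esub>t\<in>T. augmentation a \<otimes>\<^bsub>K\<^esub> (deriv_at t b \<otimes>\<^bsub>K\<^esub> m t))"
    by (rule K.finsum_addf) (simp_all add: assms M_mem)
  also have "\<dots> = augmentation b \<otimes>\<^bsub>K\<^esub> slope T a m \<oplus>\<^bsub>K\<^esub> augmentation a \<otimes>\<^bsub>K\<^esub> slope T b m"
    unfolding slope_def by (simp add: K.finsum_rdistr T_finite assms M_mem)
  finally show ?thesis .
qed

lemma slope_eq_zero: "(\<And>t. t \<in> T \<Longrightarrow> deriv_at t a \<otimes>\<^bsub>K\<^esub> m t = \<zero>\<^bsub>K\<^esub>) \<Longrightarrow> slope T a m = \<zero>\<^bsub>K\<^esub>"
  unfolding slope_def by (rule K.add.finprod_one_eqI)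

lemma slope_one: "m \<in> carrier M \<Longrightarrow> slope T \<one>\<^bsub>A\<^esub> m = \<zero>\<^bsub>K\<^esub>"
  by (rule slope_eq_zero) (simp add: deriv_one T_less M_mem)

lemma smult_M_closed: "a \<in> carrier A \<Longrightarrow> m \<in> carrier M \<Longrightarrow> a \<odot>\<^bsub>M\<^esub> m \<in> carrier M"
  using M_mem[of m] slope_closed[of a m] unfolding M_simps(4) by (simp add: M_simps(1))

lemma abelian_group_M: "abelian_group M"
  by (rule pointwise_abelian_group[OF K.abelian_group_axioms]) (simp_all add: M_simps)

lemma M_eqI:
  assumes "m \<in> carrier M" "m' \<in> carrier M" "\<And>i. i \<in> insert n T \<Longrightarrow> m i = m' i"
  shows "m = m'"
  using assms by (intro PiE_ext[of m "insert n T" "\<lambda>_. carrier K" m']) (simp_all add: M_simps)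

text \<open>The Leibniz rule in \<open>slope_mult\<close> is exactly the formula for the
  off-diagonal entry in a product of two block triangular matrices.\<close>

lemma module_M: "Module.module A M"
proof -
  interpret MG: abelian_group M by (rule abelian_group_M)
  show ?thesis
  proof (rule moduleI[OF A.cring_axioms abelian_group_M])
    fix a b m m'
    assume a: "a \<in> carrier A" and b: "b \<in> carrier A" and m: "m \<in> carrier M" and m': "m' \<in> carrier M"
    note cl = a b m m' smult_M_closed slope_closed M_mem[OF m] M_mem[OF m']
    show "(a \<oplus>\<^bsub>A\<^esub> b) \<odot>\<^bsub>M\<^esub> m = a \<odot>\<^bsub>M\<^esub> m \<oplus>\<^bsub>M\<^esub> b \<odot>\<^bsub>M\<^esub> m"
    proof (rule M_eqI)
      fix i assume "i \<in> insert n T"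
      then show "((a \<oplus>\<^bsub>A\<^esub> b) \<odot>\<^bsub>M\<^esub> m) i = (a \<odot>\<^bsub>M\<^esub> m \<oplus>\<^bsub>M\<^esub> b \<odot>\<^bsub>M\<^esub> m) i"
        by (simp add: M_apply cl slope_add_left augmentation_add K.l_distr K.a_ac)
    qed (simp_all add: cl)
    show "a \<odot>\<^bsub>M\<^esub> (m \<oplus>\<^bsub>M\<^esub> m') = a \<odot>\<^bsub>M\<^esub> m \<oplus>\<^bsub>M\<^esub> a \<odot>\<^bsub>M\<^esub> m'"
    proof (rule M_eqI)
      fix i assume "i \<in> insert n T"
      then show "(a \<odot>\<^bsub>M\<^esub> (m \<oplus>\<^bsub>M\<^esub> m')) i = (a \<odot>\<^bsub>M\<^esub> m \<oplus>\<^bsub>M\<^esub> a \<odot>\<^bsub>M\<^esub> m') i"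
        by (simp add: M_apply cl slope_add_right K.r_distr K.a_ac)
    qed (simp_all add: cl)
    \<comment> \<open>The slope reads only the top coordinates, on which \<open>b\<close> acts as
      the scalar \<open>augmentation b\<close>.\<close>
    have "slope T a (b \<odot>\<^bsub>M\<^esub> m) = augmentation b \<otimes>\<^bsub>K\<^esub> slope T a m"
    proof (rule slope_const)
      fix t assume "t \<in> T"
      then show "(b \<odot>\<^bsub>M\<^esub> m) t = augmentation b \<otimes>\<^bsub>K\<^esub> m t"
        using n_notin_T by (auto simp: M_apply cl)
    qed (simp_all add: cl)
    then show "(a \<otimes>\<^bsub>A\<^esub> b) \<odot>\<^bsub>M\<^esub> m = a \<odot>\<^bsub>M\<^esub> (b \<odot>\<^bsub>M\<^esub> m)"
      by (intro M_eqI)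
        (simp_all add: M_apply cl slope_mult augmentation_mult K.r_distr K.m_ac K.a_ac)
  next
    fix m assume m: "m \<in> carrier M"
    show "\<one>\<^bsub>A\<^esub> \<odot>\<^bsub>M\<^esub> m = m"
      by (rule M_eqI)
        (simp_all add: M_apply augmentation_one slope_one m smult_M_closed M_mem[OF m])
  qed (rule smult_M_closed)
qed

section \<open>The underlying vector space\<close>

abbreviation US :: "('k, nat \<Rightarrow> 'k) module" where "US \<equiv> underlying_space K E M"

lemma US_simps:
  "carrier US = insert n T \<rightarrow>\<^sub>E carrier K"
  "\<zero>\<^bsub>US\<^esub> = (\<lambda>i\<in>insert n T. \<zero>\<^bsub>K\<^esub>)"
  "m \<oplus>\<^bsub>US\<^esub> m' = (\<lambda>i\<in>insert n T. m i \<oplus>\<^bsub>K\<^esub> m' i)"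
  by (simp_all add: underlying_space_def M_simps)

text \<open>Derivations kill the multiples of \<open>1\<close>, so the scalar action through
  \<open>c \<cdot> 1\<close> has no off-diagonal part.\<close>

lemma US_smult:
  assumes c: "c \<in> carrier K" and m: "m \<in> carrier M"
  shows "c \<odot>\<^bsub>US\<^esub> m = (\<lambda>i\<in>insert n T. c \<otimes>\<^bsub>K\<^esub> m i)"
proof -
  have "slope T (c \<odot>\<^bsub>A\<^esub> \<one>\<^bsub>A\<^esub>) m = \<zero>\<^bsub>K\<^esub>"
    by (rule slope_eq_zero) (simp add: deriv_smult deriv_one T_less M_mem m c)
  then show ?thesis
    by (auto simp: underlying_space_def M_simps(4) augmentation_smult augmentation_one c M_mem[OF m]
        intro!: restrict_ext)
qed

lemma vectorspace_US: "vectorspace K US"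
proof -
  have car: "carrier US = carrier M" by (simp add: US_simps M_simps)
  have cl: "c \<odot>\<^bsub>US\<^esub> m \<in> carrier M" if "c \<in> carrier K" "m \<in> carrier M" for c m
    using that M_mem[OF that(2)] by (simp add: US_smult) (simp add: M_simps)
  have add_cl: "m \<oplus>\<^bsub>US\<^esub> m' \<in> carrier M" if "m \<in> carrier M" "m' \<in> carrier M" for m m'
    using M_mem[OF that(1)] M_mem[OF that(2)] by (simp add: US_simps) (simp add: M_simps)
  have abU: "abelian_group US"
    by (rule pointwise_abelian_group[OF K.abelian_group_axioms]) (simp_all add: US_simps)
  have "Module.module K US"
  proof (rule moduleI[OF K.cring_axioms abU])
    fix c d m m' assume "c \<in> carrier K" "d \<in> carrier K" "m \<in> carrier US" "m' \<in> carrier US"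
    then have c: "c \<in> carrier K" and d: "d \<in> carrier K" and m: "m \<in> carrier M" and m': "m' \<in> carrier M"
      by (simp_all add: car)
    note mem = M_mem[OF m] M_mem[OF m']
    show "(c \<oplus>\<^bsub>K\<^esub> d) \<odot>\<^bsub>US\<^esub> m = c \<odot>\<^bsub>US\<^esub> m \<oplus>\<^bsub>US\<^esub> d \<odot>\<^bsub>US\<^esub> m"
      by (auto simp: US_smult US_simps(3) c d m K.l_distr mem intro!: restrict_ext)
    show "c \<odot>\<^bsub>US\<^esub> (m \<oplus>\<^bsub>US\<^esub> m') = c \<odot>\<^bsub>US\<^esub> m \<oplus>\<^bsub>US\<^esub> c \<odot>\<^bsub>US\<^esub> m'"
      unfolding US_smult[OF c add_cl[OF m m']] US_smult[OF c m] US_smult[OF c m']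
      unfolding US_simps(3)
      by (auto simp: c K.r_distr mem intro!: restrict_ext)
    show "(c \<otimes>\<^bsub>K\<^esub> d) \<odot>\<^bsub>US\<^esub> m = c \<odot>\<^bsub>US\<^esub> (d \<odot>\<^bsub>US\<^esub> m)"
      unfolding US_smult[OF c cl[OF d m]] US_smult[OF K.m_closed[OF c d] m]
      unfolding US_smult[OF d m]
      by (auto simp: c d K.m_assoc mem intro!: restrict_ext)
  next
    fix m assume "m \<in> carrier US"
    then have m: "m \<in> carrier M" by (simp add: car)
    show "\<one>\<^bsub>K\<^esub> \<odot>\<^bsub>US\<^esub> m = m"
    proof (rule M_eqI)
      fix i assume "i \<in> insert n T"
      then show "(\<one>\<^bsub>K\<^esub> \<odot>\<^bsub>US\<^esub> m) i = m i"
        using M_mem[OF m] by (simp add: US_smult m)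
    qed (simp_all add: m cl)
  qed (simp add: car cl)
  then show ?thesis
    by (rule vectorspace.intro) (rule K.field_axioms)
qed

lemma fin_dim_US: "vectorspace.fin_dim K US"
proof -
  interpret U: vectorspace K US by (rule vectorspace_US)
  let ?e = "\<lambda>j. \<lambda>i\<in>insert n T. if i = j then \<one>\<^bsub>K\<^esub> else \<zero>\<^bsub>K\<^esub>"
  let ?B = "?e ` insert n T"
  have "?e j \<in> carrier US" for j
    by (simp add: US_simps)
  then have B: "?B \<subseteq> carrier US" by blast
  have sub: "submodule K (U.span ?B) US"
    using B by (rule U.span_is_submodule)
  have "insert n T \<rightarrow>\<^sub>E carrier K \<subseteq> U.span ?B"
  proof (rule pointwise_induct[OF K.abelian_monoid_axioms])
    show "finite (insert n T)" using T_finite by simp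
    show "(\<lambda>i\<in>insert n T. \<zero>\<^bsub>K\<^esub>) \<in> U.span ?B"
      using submodule.zero_closed[OF sub] by (simp add: US_simps)
    fix f c j assume f: "f \<in> U.span ?B" and c: "c \<in> carrier K" and j: "j \<in> insert n T"
    have ej: "?e j \<in> carrier M" by (simp add: M_simps)
    have "?e j \<in> U.span ?B"
      using U.in_own_span[OF B] j by blast
    then have "f \<oplus>\<^bsub>US\<^esub> c \<odot>\<^bsub>US\<^esub> ?e j \<in> U.span ?B"
      using f c by (intro submodule.m_closed[OF sub] submodule.smult_closed[OF sub])
    also have "f \<oplus>\<^bsub>US\<^esub> c \<odot>\<^bsub>US\<^esub> ?e j = (\<lambda>i\<in>insert n T. f i \<oplus>\<^bsub>K\<^esub> (if i = j then c else \<zero>\<^bsub>K\<^esub>))"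
      unfolding US_smult[OF c ej] US_simps(3) using c by (auto intro!: restrict_ext)
    finally show "(\<lambda>i\<in>insert n T. f i \<oplus>\<^bsub>K\<^esub> (if i = j then c else \<zero>\<^bsub>K\<^esub>)) \<in> U.span ?B" .
  qed
  moreover have "U.span ?B \<subseteq> carrier US"
    using B by (rule U.span_is_subset2)
  ultimately have "U.span ?B = carrier US"
    by (simp add: US_simps)
  moreover have "finite ?B" using T_finite by simp
  ultimately show ?thesis
    unfolding U.fin_dim_def using B by blast
qed

lemma finite_dim_M: "finite_dim_kE_module K E M"
  by (simp add: finite_dim_kE_module_def module_M fin_dim_US)

section \<open>Socle and radical layers\<close>

definition socle :: "'k \<Rightarrow> nat \<Rightarrow> 'k" where
  "socle c = (\<lambda>i\<in>insert n T. if i = n then c else \<zero>\<^bsub>K\<^esub>)"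

lemma socle_closed: "c \<in> carrier K \<Longrightarrow> socle c \<in> carrier M"
  by (auto simp: socle_def M_simps)

lemma socle_zero: "socle \<zero>\<^bsub>K\<^esub> = \<zero>\<^bsub>US\<^esub>"
  by (auto simp: socle_def US_simps intro!: restrict_ext)

lemma aug_smult_M:
  assumes "u \<in> augmentation_ideal" "m \<in> carrier M"
  shows "u \<odot>\<^bsub>M\<^esub> m = socle (slope T u m)"
  using assms slope_closed[of u m]
  by (auto simp: M_simps(4) socle_def augmentation_ideal_def M_mem intro!: restrict_ext)

text \<open>The slope reads the coordinates in \<open>T\<close>, and \<open>n \<notin> T\<close>.
  Hence two factors from the augmentation ideal annihilate the module.\<close>

lemma aug_smult_socle:
  assumes "u \<in> augmentation_ideal" "c \<in> carrier K"
  shows "u \<odot>\<^bsub>M\<^esub> socle c = socle \<zero>\<^bsub>K\<^esub>"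
proof -
  have "slope T u (socle c) = \<zero>\<^bsub>K\<^esub>"
    using assms n_notin_T by (intro slope_eq_zero) (auto simp: socle_def augmentation_ideal_def)
  then show ?thesis
    using assms socle_closed by (simp add: aug_smult_M)
qed

abbreviation Rad_gens :: "('e \<Rightarrow> 'k) set \<Rightarrow> nat \<Rightarrow> (nat \<Rightarrow> 'k) set" where
  "Rad_gens U j \<equiv> {foldr (\<lambda>u x. u \<odot>\<^bsub>M\<^esub> x) us m | us m.
     length us = j \<and> set us \<subseteq> U \<and> m \<in> carrier M}"

text \<open>The innermost factor moves \<open>m\<close> into the socle and the others keep it there;
  the empty list would leave \<open>m\<close> as it is.\<close>

lemma foldr_socle:
  assumes "set us \<subseteq> augmentation_ideal" "us \<noteq> []" "m \<in> carrier M"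
  shows "\<exists>c\<in>carrier K. foldr (\<lambda>u x. u \<odot>\<^bsub>M\<^esub> x) us m = socle c"
  using assms
proof (induction us)
  case (Cons u us)
  have u: "u \<in> augmentation_ideal" "u \<in> carrier A"
    using Cons.prems by (auto simp: augmentation_ideal_def)
  show ?case
  proof (cases "us = []")
    case True
    then show ?thesis
      using u Cons.prems slope_closed by (auto simp: aug_smult_M)
  next
    case False
    then obtain c where "c \<in> carrier K" "foldr (\<lambda>u x. u \<odot>\<^bsub>M\<^esub> x) us m = socle c"
      using Cons by auto
    then show ?thesis
      using u aug_smult_socle by auto
  qed
qed simp

lemma Rad_gens_ge_2:
  assumes U: "U \<subseteq> augmentation_ideal" "\<zero>\<^bsub>A\<^esub> \<in> U" and j: "j \<ge> 2"
  shows "Rad_gens U j = {socle \<zero>\<^bsub>K\<^esub>}"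
proof -
  have *: "foldr (\<lambda>u x. u \<odot>\<^bsub>M\<^esub> x) us m = socle \<zero>\<^bsub>K\<^esub>"
    if us: "length us = j" "set us \<subseteq> U" and m: "m \<in> carrier M" for us m
  proof -
    \<comment> \<open>The outermost factor \<open>u\<close> acts on the result of the nonempty list
      \<open>vs\<close>, which is already in the socle and so is killed.\<close>
    obtain u vs where uv: "us = u # vs" "vs \<noteq> []"
      using us j by (cases us; cases "tl us") auto
    then obtain c where "c \<in> carrier K" "foldr (\<lambda>u x. u \<odot>\<^bsub>M\<^esub> x) vs m = socle c"
      using foldr_socle[of vs m] us U m by auto
    then show ?thesis
      using uv us U aug_smult_socle by auto
  qed
  \<comment> \<open>Equality also requires a generator to exist; as \<open>\<zero>\<close> lies in
    \<open>U\<close>, a list of zeros is admissible.\<close>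
  let ?us = "replicate j \<zero>\<^bsub>A\<^esub>"
  have us: "length ?us = j" "set ?us \<subseteq> U" and m: "socle \<zero>\<^bsub>K\<^esub> \<in> carrier M"
    using U socle_closed by auto
  have "socle \<zero>\<^bsub>K\<^esub> \<in> Rad_gens U j"
    using *[OF us m, symmetric] us m by blast
  moreover have "Rad_gens U j \<subseteq> {socle \<zero>\<^bsub>K\<^esub>}"
    using * by blast
  ultimately show ?thesis by blast
qed

lemma Rad_gens_1: "Rad_gens U 1 = {u \<odot>\<^bsub>M\<^esub> m | u m. u \<in> U \<and> m \<in> carrier M}"
proof (intro equalityI subsetI)
  fix x assume "x \<in> Rad_gens U 1"
  then show "x \<in> {u \<odot>\<^bsub>M\<^esub> m | u m. u \<in> U \<and> m \<in> carrier M}"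
    by (auto simp: length_Suc_conv) blast
next
  fix x assume "x \<in> {u \<odot>\<^bsub>M\<^esub> m | u m. u \<in> U \<and> m \<in> carrier M}"
  then obtain u m where "x = u \<odot>\<^bsub>M\<^esub> m" "u \<in> U" "m \<in> carrier M" by blast
  then have "x = foldr (\<lambda>u x. u \<odot>\<^bsub>M\<^esub> x) [u] m \<and> length [u] = 1 \<and> set [u] \<subseteq> U \<and> m \<in> carrier M"
    by simp
  then show "x \<in> Rad_gens U 1" by blast
qed

lemma Rad_gens_1_zero:
  assumes U: "U \<subseteq> augmentation_ideal" "\<zero>\<^bsub>A\<^esub> \<in> U"
    and d: "\<And>u t. \<lbrakk>u \<in> U; t \<in> T\<rbrakk> \<Longrightarrow> deriv_at t u = \<zero>\<^bsub>K\<^esub>"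
  shows "Rad_gens U 1 = {socle \<zero>\<^bsub>K\<^esub>}"
proof -
  have *: "u \<odot>\<^bsub>M\<^esub> m = socle \<zero>\<^bsub>K\<^esub>" if "u \<in> U" "m \<in> carrier M" for u m
  proof -
    have "slope T u m = \<zero>\<^bsub>K\<^esub>"
      using that d M_mem by (intro slope_eq_zero) auto
    then show ?thesis
      using that U by (auto simp: aug_smult_M)
  qed
  show ?thesis
  proof (rule equalityI)
    show "Rad_gens U 1 \<subseteq> {socle \<zero>\<^bsub>K\<^esub>}"
      unfolding Rad_gens_1 using * by blast
    have "\<zero>\<^bsub>A\<^esub> \<odot>\<^bsub>M\<^esub> socle \<zero>\<^bsub>K\<^esub> \<in> Rad_gens U 1"
      unfolding Rad_gens_1 using U(2) socle_closed[OF K.zero_closed] by blast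
    then show "{socle \<zero>\<^bsub>K\<^esub>} \<subseteq> Rad_gens U 1"
      by (simp only: *[OF U(2) socle_closed[OF K.zero_closed]] insert_subset empty_subsetI simp_thms)
  qed
qed

text \<open>On vectors supported at \<open>t\<close> the slope of \<open>u\<close> is multiplication
  by the nonzero scalar \<open>deriv_at t u\<close>. The generators therefore fill the whole socle
  before any span is taken.\<close>

lemma Rad_gens_1_line:
  assumes U: "U \<subseteq> augmentation_ideal"
    and u: "u \<in> U" "t \<in> T" "deriv_at t u \<noteq> \<zero>\<^bsub>K\<^esub>"
  shows "Rad_gens U 1 = socle ` carrier K"
proof
  show "Rad_gens U 1 \<subseteq> socle ` carrier K"
    unfolding Rad_gens_1 using U slope_closed by (auto simp: aug_smult_M augmentation_ideal_def)
  show "socle ` carrier K \<subseteq> Rad_gens U 1"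
  proof
    fix x assume "x \<in> socle ` carrier K"
    then obtain c where c: "c \<in> carrier K" "x = socle c" by auto
    have uA: "u \<in> carrier A" using u U by (auto simp: augmentation_ideal_def)
    let ?d = "deriv_at t u"
    have inv: "inv\<^bsub>K\<^esub> ?d \<in> carrier K" "?d \<otimes>\<^bsub>K\<^esub> inv\<^bsub>K\<^esub> ?d = \<one>\<^bsub>K\<^esub>"
      using u(3) uA K.field_Units by auto
    \<comment> \<open>Supported at \<open>t\<close> alone, with the value that makes the slope equal
      to \<open>c\<close>.\<close>
    let ?m = "\<lambda>i\<in>insert n T. if i = t then inv\<^bsub>K\<^esub> ?d \<otimes>\<^bsub>K\<^esub> c else \<zero>\<^bsub>K\<^esub>"
    have m: "?m \<in> carrier M" using inv c by (simp add: M_simps)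
    have "slope T u ?m = (\<Oplus>\<^bsub>K\<^esub>i\<in>T. if t = i then ?d \<otimes>\<^bsub>K\<^esub> (inv\<^bsub>K\<^esub> ?d \<otimes>\<^bsub>K\<^esub> c) else \<zero>\<^bsub>K\<^esub>)"
      unfolding slope_def by (rule K.finsum_cong') (use uA inv c in auto)
    also have "\<dots> = ?d \<otimes>\<^bsub>K\<^esub> (inv\<^bsub>K\<^esub> ?d \<otimes>\<^bsub>K\<^esub> c)"
      by (rule K.finsum_singleton) (use u T_finite uA inv c in auto)
    also have "\<dots> = c"
      using inv c uA by (simp add: K.m_assoc[symmetric])
    finally have "u \<odot>\<^bsub>M\<^esub> ?m = x"
      using u U m c by (auto simp: aug_smult_M)
    then show "x \<in> Rad_gens U 1"
      unfolding Rad_gens_1 using u m by blast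
  qed
qed

lemma Rad_U_eq: "Rad_U K E U j M = LinearCombinations.module.span K US (Rad_gens U j)"
  by (simp add: Rad_U_def)

lemma subspace_dim_zero: "subspace_dim K US (LinearCombinations.module.span K US {socle \<zero>\<^bsub>K\<^esub>}) = 0"
proof -
  interpret U: vectorspace K US by (rule vectorspace_US)
  have B: "{\<zero>\<^bsub>US\<^esub>} \<subseteq> carrier US" by simp
  have W: "vectorspace K (U.vs (U.span {\<zero>\<^bsub>US\<^esub>}))"
    by (intro U.subspace_is_vs U.span_is_subspace B)
  show ?thesis
    unfolding socle_zero subspace_dim_def
    by (rule vectorspace.dim0I[OF W])
      (use U.span_li_not_depend(1)[OF U.in_own_span[OF B] U.span_is_submodule[OF B]] in simp)
qed

text \<open>All these vectors are multiples of \<open>socle \<one>\<close>, whose coordinate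
  \<open>n\<close> is nonzero.\<close>

lemma subspace_dim_line: "subspace_dim K US (LinearCombinations.module.span K US (socle ` carrier K)) = 1"
proof -
  interpret U: vectorspace K US by (rule vectorspace_US)
  have car: "carrier US = carrier M" by (simp add: US_simps M_simps)
  let ?e = "socle \<one>\<^bsub>K\<^esub>"
  have e: "?e \<in> carrier M" by (simp add: socle_closed)
  have B: "{?e} \<subseteq> carrier US" using e car by simp
  have sub: "submodule K (U.span {?e}) US" using B by (rule U.span_is_submodule)
  have eW: "?e \<in> U.span {?e}" using U.in_own_span[OF B] by simp
  have "socle c \<in> U.span {?e}" if c: "c \<in> carrier K" for c
  proof -
    have "socle c = c \<odot>\<^bsub>US\<^esub> ?e"
      unfolding US_smult[OF c e] using c by (auto simp: socle_def intro!: restrict_ext)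
    then show ?thesis
      using submodule.smult_closed[OF sub c eW] by simp
  qed
  then have "U.span (socle ` carrier K) \<subseteq> U.span {?e}"
    by (intro U.span_is_subset sub) auto
  moreover have "U.span {?e} \<subseteq> U.span (socle ` carrier K)"
    by (intro U.span_is_monotone) auto
  ultimately have eq: "U.span (socle ` carrier K) = U.span {?e}" by auto
  have W: "vectorspace K (U.vs (U.span {?e}))"
    by (intro U.subspace_is_vs U.span_is_subspace B)
  have "?e n \<noteq> \<zero>\<^bsub>US\<^esub> n"
    by (simp add: socle_def US_simps)
  then have "?e \<noteq> \<zero>\<^bsub>US\<^esub>" by auto
  then show ?thesis
    unfolding eq subspace_dim_def
    by (intro vectorspace.dim1I[OF W])
      (use eW U.span_li_not_depend(1)[OF U.in_own_span[OF B] sub] in simp_all)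
qed

end

end

section \<open>Radical types of the module\<close>

context rad_complement_space
begin

lemma coord_space_in_subspaces: "S \<subseteq> {..<n} \<Longrightarrow> coord_space S \<in> subspaces_of_dim K E V (card S)"
  by (simp add: subspaces_of_dim_def coord_space_subspace coord_space_subset coord_space_dim)

lemma subspaces_of_dimD:
  assumes "U \<in> subspaces_of_dim K E V r"
  shows "VectorSpace.subspace K U A" "U \<subseteq> V" "subspace_dim K A U = r"
    "U \<subseteq> augmentation_ideal" "\<zero>\<^bsub>A\<^esub> \<in> U"
proof -
  show sub: "VectorSpace.subspace K U A" and UV: "U \<subseteq> V" and "subspace_dim K A U = r"
    using assms by (simp_all add: subspaces_of_dim_def)
  show "U \<subseteq> augmentation_ideal" using UV V_aug by (rule order_trans)
  have "submodule K U A" using sub by simp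
  then show "\<zero>\<^bsub>A\<^esub> \<in> U" by (rule submodule.zero_closed)
qed

text \<open>The generating set \<open>?g j\<close> depends on \<open>j\<close> but not on
  \<open>U\<close>, so for each \<open>j\<close> the subspaces themselves coincide, not merely their
  dimensions.\<close>

lemma ext_module_constant_radical_type:
  assumes r: "1 \<le> r" "r \<le> n"
  shows "constant_radical_type K p E V r (ext_module {r - 1..<n})"
proof -
  let ?T = "{r - 1..<n}"
  have T: "?T \<subseteq> {..<n}" by auto
  let ?g = "\<lambda>j. if j = 1 then socle ?T ` carrier K else {socle ?T \<zero>\<^bsub>K\<^esub>}"
  have "Rad_U K E U j (ext_module ?T) =
      LinearCombinations.module.span K (underlying_space K E (ext_module ?T)) (?g j)"
    if U: "U \<in> subspaces_of_dim K E V r" and j: "1 \<le> j" for U j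
  proof (cases "j = 1")
    case True
    \<comment> \<open>Otherwise \<open>U\<close> would live on the \<open>r - 1\<close> coordinates
      below \<open>T\<close>, too few for dimension \<open>r\<close>.\<close>
    have "\<exists>u\<in>U. \<exists>t\<in>?T. deriv_at t u \<noteq> \<zero>\<^bsub>K\<^esub>"
    proof (rule ccontr)
      assume "\<not> ?thesis"
      then have "subspace_dim K A U \<le> card {..<r - 1}"
        using r by (intro dim_le_card_if_derivs_zero subspaces_of_dimD[OF U]) auto
      with subspaces_of_dimD(3)[OF U] r show False by simp
    qed
    then obtain u t where "u \<in> U" "t \<in> ?T" "deriv_at t u \<noteq> \<zero>\<^bsub>K\<^esub>"
      by blast
    then have "Rad_gens ?T U 1 = socle ?T ` carrier K"
      by (rule Rad_gens_1_line[OF T subspaces_of_dimD(4)[OF U]])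
    with True show ?thesis
      by (simp only: Rad_U_eq[OF T] if_True simp_thms)
  next
    case False
    then show ?thesis
      using Rad_gens_ge_2[OF T subspaces_of_dimD(4,5)[OF U], of j] j
      by (simp add: Rad_U_eq[OF T] del: One_nat_def)
  qed
  then show ?thesis
    unfolding constant_radical_type_def by metis
qed

text \<open>The comparison is made at \<open>j = 1\<close>, the only exponent at which a radical
  layer can be nonzero, between two coordinate subspaces of dimension \<open>s\<close>.\<close>

lemma ext_module_not_constant_radical_type:
  assumes s: "1 \<le> s" "s < r" and r: "r \<le> n"
  shows "\<not> constant_radical_type K p E V s (ext_module {r - 1..<n})"
proof
  let ?T = "{r - 1..<n}"
  have T: "?T \<subseteq> {..<n}" by auto
  \<comment> \<open>As \<open>s \<le> r - 1\<close>, the set \<open>?S0\<close> is disjoint from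
    \<open>?T\<close>. In \<open>?S1\<close> the index \<open>s - 1\<close> is exchanged for
    \<open>n - 1\<close>, which belongs to \<open>?T\<close>.\<close>
  let ?S0 = "{..<s}" and ?S1 = "insert (n - 1) {..<s - 1}"
  let ?dim = "\<lambda>S. subspace_dim K (underlying_space K E (ext_module ?T)) (Rad_U K E (coord_space S) 1 (ext_module ?T))"
  have S: "?S0 \<subseteq> {..<n}" "?S1 \<subseteq> {..<n}"
    using s r by auto
  have card: "card ?S0 = s" "card ?S1 = s"
    using s r by auto
  note mem = coord_space_in_subspaces[OF S(1), unfolded card] coord_space_in_subspaces[OF S(2), unfolded card]
  assume "constant_radical_type K p E V s (ext_module ?T)"
  \<comment> \<open>The exponent \<open>1\<close> lies in the tested range because
    \<open>p \<ge> 2\<close> and \<open>s \<ge> 1\<close>.\<close>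
  moreover have "1 \<le> (p - 1) * s"
    using p_ge_2 s by simp
  ultimately have "?dim ?S0 = ?dim ?S1"
    using mem unfolding constant_radical_type_def by blast
  moreover have "?dim ?S0 = 0"
  proof -
    have "deriv_at t u = \<zero>\<^bsub>K\<^esub>" if "u \<in> coord_space ?S0" "t \<in> ?T" for u t
      using that s by (intro deriv_coord_space[OF S(1)]) auto
    then have "Rad_gens ?T (coord_space ?S0) 1 = {socle ?T \<zero>\<^bsub>K\<^esub>}"
      by (intro Rad_gens_1_zero[OF T subspaces_of_dimD(4,5)[OF mem(1)]])
    then show ?thesis
      by (simp only: Rad_U_eq[OF T] subspace_dim_zero[OF T])
  qed
  moreover have "?dim ?S1 = 1"
  proof -
    have n1: "n - 1 < n" "n - 1 \<in> ?T" using s r by auto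
    have "dual_vector (n - 1) \<in> coord_space ?S1"
      unfolding coord_space_def using AV.in_own_span[OF dual_vectors_carrier[OF S(2)]] by blast
    moreover have "deriv_at (n - 1) (dual_vector (n - 1)) \<noteq> \<zero>\<^bsub>K\<^esub>"
      using dual_vector(2)[OF n1(1) n1(1)] by simp
    ultimately have "Rad_gens ?T (coord_space ?S1) 1 = socle ?T ` carrier K"
      using n1(2) by (intro Rad_gens_1_line[OF T subspaces_of_dimD(4)[OF mem(2)]])
    then show ?thesis
      by (simp only: Rad_U_eq[OF T] subspace_dim_line[OF T])
  qed
  ultimately show False by simp
qed

end

theorem corollary5p8:
  fixes K :: "('k, 'r) ring_scheme"
    and E :: "('e, 'g) monoid_scheme"
    and V :: "('e \<Rightarrow> 'k) set"
    and p n r :: nat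
  assumes "algebraically_closed K"
    and "has_characteristic K p" and "p > 0"
    and "elementary_abelian p n E"
    and "rad_complement K E V"
    and "1 < r" and "r < n"
  shows "\<exists>M :: ('e \<Rightarrow> 'k, nat \<Rightarrow> 'k) module.
           finite_dim_kE_module K E M \<and>
           constant_radical_type K p E V r M \<and>
           (\<forall>s. 1 \<le> s \<and> s < r \<longrightarrow> \<not> constant_radical_type K p E V s M)"
proof -
  interpret K: field K
    using assms(1) by (rule algebraically_closed.axioms)
  have prime: "Factorial_Ring.prime p"
    using assms(2,3) by (rule K.characteristic_prime)
  have char: "add_pow K p \<one>\<^bsub>K\<^esub> = \<zero>\<^bsub>K\<^esub>"
    using assms(2) by (simp add: has_characteristic_def)
  \<comment> \<open>The isomorphism with the product of cyclic groups serves as the coordinate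
    system on \<open>E\<close>.\<close>
  obtain f where E: "group E" and f: "f \<in> iso E (product_group {..<n} (\<lambda>_. integer_mod_group p))"
    using assms(4) by (auto simp: elementary_abelian_def is_iso_def)
  interpret rad_complement_space K E p n f V
  proof (intro rad_complement_space.intro elementary_abelian_group_ring.intro group_ring.intro)
    show "field K" by (rule K.field_axioms)
    show "comm_group E" "group_ring_axioms E"
      using elementary_abelian_finite_comm[OF E assms(3) f] by (simp_all add: group_ring_axioms_def)
    show "elementary_abelian_group_ring_axioms K E p n f"
      using prime char f by (simp add: elementary_abelian_group_ring_axioms_def)
    show "rad_complement_space_axioms K E V"
      using assms(5) by (simp add: rad_complement_space_axioms_def)
  qed
  let ?M = "ext_module {r - 1..<n}"
  have "finite_dim_kE_module K E ?M"
    by (rule finite_dim_M) auto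
  moreover have "constant_radical_type K p E V r ?M"
    using assms(6,7) by (intro ext_module_constant_radical_type) auto
  moreover have "\<forall>s. 1 \<le> s \<and> s < r \<longrightarrow> \<not> constant_radical_type K p E V s ?M"
    using assms(7) ext_module_not_constant_radical_type by auto
  ultimately show ?thesis by blast
qed

end
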